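(* Let $\mathfrak{M}$, $A$, $B$, $\sigma$, $\pi$ be as in the context (a bialgebra $A$ in an abelian and coabelian braided monoidal category with a right weak projection $\pi$ onto a sub-bialgebra $B$ with antipode), and let $R$, $i$, $p$ and the morphisms $m_R,u_R,\Delta_R,\varepsilon_R,\xi,{}^{B}\!\mu_R,{}^{B}\!\rho_R,\mu_B^R$ be as defined in the context. 1) The object $R$ is a coalgebra in $\mathfrak{M}$ with comultiplication $\Delta_R$ and counit $\varepsilon_R$, and $p:A\to R$ is a coalgebra homomorphism. 2) The morphisms $m_A(i\otimes\sigma):R\otimes B\to A$ and $(p\otimes\pi)\Delta_A:A\to R\otimes B$ are mutual inverses, so that $R\otimes B$ inherits a bialgebra structure (transported from $A$ along these isomorphisms), which is the cross product bialgebra $R\rtimes B$ defined by \begin{align*} m_{R\rtimes B}=\;&(R\otimes m_B)(m_R\otimes\xi\otimes B)(R\otimes{}^{B}\!\mu_R\otimes R\otimes R\otimes m_B)(R\otimes B\otimes c_{R,R}\otimes R\otimes B\otimes B)\\ &(R\otimes{}^{B}\!\rho_R\otimes R\otimes R\otimes B\otimes B)(\Delta_R\otimes\Delta_R\otimes B\otimes B)(R\otimes{}^{B}\!\mu_R\otimes\mu_B^R\otimes B)\\ &(R\otimes B\otimes c_{B,R}\otimes R\otimes B)(R\otimes\Delta_B\otimes\Delta_R\otimes B),\\ u_{R\rtimes B}=\;&(u_R\otimes u_B)\Delta_{\mathbf 1},\\ \Delta_{R\rtimes B}=\;&(R\otimes m_B\otimes R\otimes B)(R\otimes B\otimes c_{R,B}\otimes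 B)(R\otimes{}^{B}\!\rho_R\otimes B\otimes B)(\Delta_R\otimes\Delta_B),\\ \varepsilon_{R\rtimes B}=\;&m_{\mathbf 1}(\varepsilon_R\otimes\varepsilon_B). \end{align*}
   Context: Conventions: associativity constraints are suppressed; an object used as a morphism denotes its identity; $l_X:\mathbf{1}\otimes X\to X$ and $r_X:X\otimes\mathbf{1}\to X$ are the unit constraints; $m_{\mathbf 1}:\mathbf 1\otimes\mathbf 1\to\mathbf 1$ is the canonical isomorphism and $\Delta_{\mathbf 1}$ its inverse. $(\mathfrak{M},\otimes,\mathbf{1},c)$ is an abelian and coabelian braided monoidal category: $\mathfrak{M}$ is an abelian category and for every $X$ the functors $X\otimes(-)$ and $(-)\otimes X$ are additive, right exact (abelian) and left exact (coabelian). The braiding is a natural isomorphism $c_{X,Y}:X\otimes Y\to Y\otimes X$ with $c_{X\otimes Y,Z}=(c_{X,Z}\otimes Y)(X\otimes c_{Y,Z})$ and $c_{X,Y\otimes Z}=(Y\otimes c_{X,Z})(c_{X,Y}\otimes Z)$. A bialgebra $(B,m,u,\Delta,\varepsilon)$ in $\mathfrak{M}$ is an algebra and a coalgebra with $\Delta m=(m\otimes m)(B\otimes c_{B,B}\otimes B)(\Delta\otimes\Delta)$, $\varepsilon m=m_{\mathbf 1}(\varepsilon\otimes\varepsilon)$, $\Delta u=(u\otimes u)\Delta_{\mathbf 1}$, $\varepsilon u=\mathrm{Id}_{\mathbf 1}$. An antipode is $S:B\to B$ with $m(S\otimes B)\Delta=u\varepsilon=m(B\otimes S)\Delta$. Setting: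 $(A,m_A,u_A,\Delta_A,\varepsilon_A)$ is a bialgebra in $\mathfrak{M}$; $(B,m_B,u_B,\Delta_B,\varepsilon_B)$ is a sub-bialgebra of $A$ with an antipode $S_B$; $\sigma:B\to A$ is the canonical inclusion (a bialgebra morphism and a monomorphism); $\pi:A\to B$ is a right weak projection onto $B$, i.e. a coalgebra homomorphism with $\pi m_A(A\otimes\sigma)=m_B(\pi\otimes B)$ (right $B$-linearity) and $\pi\sigma=\mathrm{Id}_B$. Put $\Phi:=\sigma S_B\pi$ and $\Pi_2:=m_A(A\otimes\Phi)\Delta_A$. The diagram of $A$ is the equalizer $(R,i)$, $i:R\to A$, of $(A\otimes\pi)\Delta_A$ and $(A\otimes u_B)r_A^{-1}$ from $A$ to $A\otimes B$; $p:A\to R$ is the unique morphism such that $ip=\Pi_2$ and $pi=\mathrm{Id}_R$ (it exists). Associated data: $m_R:=p\,m_A(i\otimes i):R\otimes R\to R$; $u_R:=p\,u_A:\mathbf 1\to R$; $\Delta_R:=(p\otimes p)\Delta_A i:R\to R\otimes R$; $\varepsilon_R:=\varepsilon_A i:R\to\mathbf 1$; $\xi:=\pi m_A(i\otimes i):R\otimes R\to B$; ${}^{B}\!\mu_R:=p\,m_A(\sigma\otimes i):B\otimes R\to R$; ${}^{B}\!\rho_R:=(\pi\otimes p)\Delta_A i:R\to B\otimes R$; $\mu_B^R:=\pi m_A(\sigma\otimes i):B\otimes R\to B$. *)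

theory Defs
  imports "HOL-Algebra.Group"
begin

section \<open>Categories\<close>

record ('o, 'm) category =
  Obj :: "'o set"
  Arr :: "'m set"
  Dom :: "'m \<Rightarrow> 'o"
  Cod :: "'m \<Rightarrow> 'o"
  idn :: "'o \<Rightarrow> 'm" ("idn\<index>")
  compose :: "'m \<Rightarrow> 'm \<Rightarrow> 'm" (infixr "\<cdot>\<index>" 55)

definition arrows :: "('o, 'm, 'x) category_scheme \<Rightarrow> 'o \<Rightarrow> 'o \<Rightarrow> 'm set" ("Hom\<index>")
  where "Hom\<^bsub>C\<^esub> X Y = {f \<in> Arr C. Dom C f = X \<and> Cod C f = Y}"

locale category =
  fixes C :: "('o, 'm, 'x) category_scheme" (structure)
  assumes dom_obj: "f \<in> Arr C \<Longrightarrow> Dom C f \<in> Obj C"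
    and cod_obj: "f \<in> Arr C \<Longrightarrow> Cod C f \<in> Obj C"
    and id_hom: "X \<in> Obj C \<Longrightarrow> idn X \<in> Hom X X"
    and comp_hom: "f \<in> Hom X Y \<Longrightarrow> g \<in> Hom Y Z \<Longrightarrow> g \<cdot> f \<in> Hom X Z"
    and id_right: "f \<in> Hom X Y \<Longrightarrow> f \<cdot> idn X = f"
    and id_left: "f \<in> Hom X Y \<Longrightarrow> idn Y \<cdot> f = f"
    and comp_assoc: "f \<in> Hom W X \<Longrightarrow> g \<in> Hom X Y \<Longrightarrow> h \<in> Hom Y Z
      \<Longrightarrow> (h \<cdot> g) \<cdot> f = h \<cdot> (g \<cdot> f)"

context
  fixes C :: "('o, 'm, 'x) category_scheme" (structure)
begin

definition monomorphism :: "'m \<Rightarrow> bool" where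
  "monomorphism f \<longleftrightarrow> f \<in> Arr C \<and>
    (\<forall>W. \<forall>g \<in> Hom W (Dom C f). \<forall>h \<in> Hom W (Dom C f). f \<cdot> g = f \<cdot> h \<longrightarrow> g = h)"

definition epimorphism :: "'m \<Rightarrow> bool" where
  "epimorphism f \<longleftrightarrow> f \<in> Arr C \<and>
    (\<forall>Z. \<forall>g \<in> Hom (Cod C f) Z. \<forall>h \<in> Hom (Cod C f) Z. g \<cdot> f = h \<cdot> f \<longrightarrow> g = h)"

definition inverse_arrows :: "'m \<Rightarrow> 'm \<Rightarrow> bool" where
  "inverse_arrows f g \<longleftrightarrow> f \<in> Arr C \<and> g \<in> Hom (Cod C f) (Dom C f) \<and>
    g \<cdot> f = idn (Dom C f) \<and> f \<cdot> g = idn (Cod C f)"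

definition isomorphism :: "'m \<Rightarrow> bool" where
  "isomorphism f \<longleftrightarrow> (\<exists>g. inverse_arrows f g)"

definition inv_arr :: "'m \<Rightarrow> 'm" where
  "inv_arr f = (THE g. inverse_arrows f g)"

definition is_equalizer :: "'o \<Rightarrow> 'm \<Rightarrow> 'm \<Rightarrow> 'm \<Rightarrow> bool" where
  "is_equalizer E e f g \<longleftrightarrow>
    f \<in> Arr C \<and> g \<in> Hom (Dom C f) (Cod C f) \<and> e \<in> Hom E (Dom C f) \<and> f \<cdot> e = g \<cdot> e \<and>
    (\<forall>W. \<forall>h \<in> Hom W (Dom C f). f \<cdot> h = g \<cdot> h \<longrightarrow> (\<exists>!k. k \<in> Hom W E \<and> e \<cdot> k = h))"

definition zero_object :: "'o \<Rightarrow> bool" where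
  "zero_object Z \<longleftrightarrow> Z \<in> Obj C \<and> (\<forall>X \<in> Obj C. (\<exists>!f. f \<in> Hom X Z) \<and> (\<exists>!f. f \<in> Hom Z X))"

end


section \<open>Abelian categories\<close>

record ('o, 'm) preadditive = "('o, 'm) category" +
  hzero :: "'o \<Rightarrow> 'o \<Rightarrow> 'm" ("\<zero>\<index>")
  hadd :: "'m \<Rightarrow> 'm \<Rightarrow> 'm" (infixl "\<oplus>\<index>" 65)

locale preadditive = category C for C :: "('o, 'm, 'x) preadditive_scheme" (structure) +
  assumes hom_group: "X \<in> Obj C \<Longrightarrow> Y \<in> Obj C \<Longrightarrow>
      comm_group \<lparr>carrier = Hom X Y, monoid.mult = hadd C, one = \<zero> X Y\<rparr>"
    and comp_add_right: "f \<in> Hom X Y \<Longrightarrow> f' \<in> Hom X Y \<Longrightarrow> g \<in> Hom Y Z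
      \<Longrightarrow> g \<cdot> (f \<oplus> f') = (g \<cdot> f) \<oplus> (g \<cdot> f')"
    and comp_add_left: "f \<in> Hom X Y \<Longrightarrow> g \<in> Hom Y Z \<Longrightarrow> g' \<in> Hom Y Z
      \<Longrightarrow> (g \<oplus> g') \<cdot> f = (g \<cdot> f) \<oplus> (g' \<cdot> f)"

context
  fixes C :: "('o, 'm, 'x) preadditive_scheme" (structure)
begin

definition is_kernel :: "'m \<Rightarrow> 'm \<Rightarrow> bool" where
  "is_kernel k f \<longleftrightarrow>
    f \<in> Arr C \<and> k \<in> Hom (Dom C k) (Dom C f) \<and> f \<cdot> k = \<zero> (Dom C k) (Cod C f) \<and>
    (\<forall>W. \<forall>h \<in> Hom W (Dom C f). f \<cdot> h = \<zero> W (Cod C f)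
      \<longrightarrow> (\<exists>!t. t \<in> Hom W (Dom C k) \<and> k \<cdot> t = h))"

definition is_cokernel :: "'m \<Rightarrow> 'm \<Rightarrow> bool" where
  "is_cokernel q f \<longleftrightarrow>
    f \<in> Arr C \<and> q \<in> Hom (Cod C f) (Cod C q) \<and> q \<cdot> f = \<zero> (Dom C f) (Cod C q) \<and>
    (\<forall>W. \<forall>h \<in> Hom (Cod C f) W. h \<cdot> f = \<zero> (Dom C f) W
      \<longrightarrow> (\<exists>!t. t \<in> Hom (Cod C q) W \<and> t \<cdot> q = h))"

definition is_biproduct :: "'o \<Rightarrow> 'o \<Rightarrow> 'o \<Rightarrow> 'm \<Rightarrow> 'm \<Rightarrow> 'm \<Rightarrow> 'm \<Rightarrow> bool" where
  "is_biproduct X Y P j\<^sub>1 j\<^sub>2 q\<^sub>1 q\<^sub>2 \<longleftrightarrow>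
    j\<^sub>1 \<in> Hom X P \<and> j\<^sub>2 \<in> Hom Y P \<and> q\<^sub>1 \<in> Hom P X \<and> q\<^sub>2 \<in> Hom P Y \<and>
    q\<^sub>1 \<cdot> j\<^sub>1 = idn X \<and> q\<^sub>2 \<cdot> j\<^sub>2 = idn Y \<and> q\<^sub>2 \<cdot> j\<^sub>1 = \<zero> X Y \<and> q\<^sub>1 \<cdot> j\<^sub>2 = \<zero> Y X \<and>
    (j\<^sub>1 \<cdot> q\<^sub>1) \<oplus> (j\<^sub>2 \<cdot> q\<^sub>2) = idn P"

text \<open>Endofunctors are given by their action on morphisms. Right exactness is
  preservation of exact sequences \<open>X \<rightarrow> Y \<rightarrow> Z \<rightarrow> 0\<close>, which say that \<open>Y \<rightarrow> Z\<close> is a cokernel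
  of \<open>X \<rightarrow> Y\<close>; dually for left exactness.\<close>

definition additive_on_arrows :: "('m \<Rightarrow> 'm) \<Rightarrow> bool" where
  "additive_on_arrows F \<longleftrightarrow>
    (\<forall>X Y. \<forall>f \<in> Hom X Y. \<forall>g \<in> Hom X Y. F (f \<oplus> g) = F f \<oplus> F g)"

definition right_exact :: "('m \<Rightarrow> 'm) \<Rightarrow> bool" where
  "right_exact F \<longleftrightarrow> (\<forall>f q. is_cokernel q f \<longrightarrow> is_cokernel (F q) (F f))"

definition left_exact :: "('m \<Rightarrow> 'm) \<Rightarrow> bool" where
  "left_exact F \<longleftrightarrow> (\<forall>f k. is_kernel k f \<longrightarrow> is_kernel (F k) (F f))"

end

locale abelian_category = preadditive +
  assumes zero_object_exists: "\<exists>Z. zero_object C Z"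
    and biproducts: "X \<in> Obj C \<Longrightarrow> Y \<in> Obj C \<Longrightarrow> \<exists>P j\<^sub>1 j\<^sub>2 q\<^sub>1 q\<^sub>2. is_biproduct C X Y P j\<^sub>1 j\<^sub>2 q\<^sub>1 q\<^sub>2"
    and kernels: "f \<in> Arr C \<Longrightarrow> \<exists>k. is_kernel C k f"
    and cokernels: "f \<in> Arr C \<Longrightarrow> \<exists>q. is_cokernel C q f"
    and mono_normal: "monomorphism C k \<Longrightarrow> \<exists>f. is_kernel C k f"
    and epi_normal: "epimorphism C q \<Longrightarrow> \<exists>f. is_cokernel C q f"


section \<open>Braided monoidal categories\<close>

record ('o, 'm) braided_monoidal = "('o, 'm) preadditive" +
  tens_o :: "'o \<Rightarrow> 'o \<Rightarrow> 'o" (infixr "\<otimes>\<^sub>o\<index>" 70)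
  tens_m :: "'m \<Rightarrow> 'm \<Rightarrow> 'm" (infixr "\<otimes>\<^sub>m\<index>" 70)
  unit_o :: "'o" ("\<I>\<index>")
  assoc :: "'o \<Rightarrow> 'o \<Rightarrow> 'o \<Rightarrow> 'm" ("\<a>\<index>")
  lunit :: "'o \<Rightarrow> 'm" ("\<l>\<index>")
  runit :: "'o \<Rightarrow> 'm" ("\<r>\<index>")
  braid :: "'o \<Rightarrow> 'o \<Rightarrow> 'm" ("\<c>\<index>")

locale monoidal_category =
  category M for M :: "('o, 'm, 'x) braided_monoidal_scheme" (structure) +
  assumes unit_obj: "\<I> \<in> Obj M"
    and tens_obj: "X \<in> Obj M \<Longrightarrow> Y \<in> Obj M \<Longrightarrow> X \<otimes>\<^sub>o Y \<in> Obj M"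
    and tens_hom: "f \<in> Hom X Y \<Longrightarrow> g \<in> Hom X' Y' \<Longrightarrow> f \<otimes>\<^sub>m g \<in> Hom (X \<otimes>\<^sub>o X') (Y \<otimes>\<^sub>o Y')"
    and tens_id: "X \<in> Obj M \<Longrightarrow> Y \<in> Obj M \<Longrightarrow> idn X \<otimes>\<^sub>m idn Y = idn (X \<otimes>\<^sub>o Y)"
    and tens_comp: "f \<in> Hom X Y \<Longrightarrow> g \<in> Hom Y Z \<Longrightarrow> f' \<in> Hom X' Y' \<Longrightarrow> g' \<in> Hom Y' Z'
      \<Longrightarrow> (g \<cdot> f) \<otimes>\<^sub>m (g' \<cdot> f') = (g \<otimes>\<^sub>m g') \<cdot> (f \<otimes>\<^sub>m f')"
    and assoc_hom: "X \<in> Obj M \<Longrightarrow> Y \<in> Obj M \<Longrightarrow> Z \<in> Obj M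
      \<Longrightarrow> \<a> X Y Z \<in> Hom ((X \<otimes>\<^sub>o Y) \<otimes>\<^sub>o Z) (X \<otimes>\<^sub>o (Y \<otimes>\<^sub>o Z))"
    and assoc_iso: "X \<in> Obj M \<Longrightarrow> Y \<in> Obj M \<Longrightarrow> Z \<in> Obj M \<Longrightarrow> isomorphism M (\<a> X Y Z)"
    and assoc_natural: "f \<in> Hom X X' \<Longrightarrow> g \<in> Hom Y Y' \<Longrightarrow> h \<in> Hom Z Z'
      \<Longrightarrow> \<a> X' Y' Z' \<cdot> ((f \<otimes>\<^sub>m g) \<otimes>\<^sub>m h) = (f \<otimes>\<^sub>m (g \<otimes>\<^sub>m h)) \<cdot> \<a> X Y Z"
    and lunit_hom: "X \<in> Obj M \<Longrightarrow> \<l> X \<in> Hom (\<I> \<otimes>\<^sub>o X) X"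
    and lunit_iso: "X \<in> Obj M \<Longrightarrow> isomorphism M (\<l> X)"
    and lunit_natural: "f \<in> Hom X Y \<Longrightarrow> \<l> Y \<cdot> (idn \<I> \<otimes>\<^sub>m f) = f \<cdot> \<l> X"
    and runit_hom: "X \<in> Obj M \<Longrightarrow> \<r> X \<in> Hom (X \<otimes>\<^sub>o \<I>) X"
    and runit_iso: "X \<in> Obj M \<Longrightarrow> isomorphism M (\<r> X)"
    and runit_natural: "f \<in> Hom X Y \<Longrightarrow> \<r> Y \<cdot> (f \<otimes>\<^sub>m idn \<I>) = f \<cdot> \<r> X"
    and pentagon: "W \<in> Obj M \<Longrightarrow> X \<in> Obj M \<Longrightarrow> Y \<in> Obj M \<Longrightarrow> Z \<in> Obj M
      \<Longrightarrow> (idn W \<otimes>\<^sub>m \<a> X Y Z) \<cdot> \<a> W (X \<otimes>\<^sub>o Y) Z \<cdot> (\<a> W X Y \<otimes>\<^sub>m idn Z)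
          = \<a> W X (Y \<otimes>\<^sub>o Z) \<cdot> \<a> (W \<otimes>\<^sub>o X) Y Z"
    and triangle: "X \<in> Obj M \<Longrightarrow> Y \<in> Obj M
      \<Longrightarrow> (idn X \<otimes>\<^sub>m \<l> Y) \<cdot> \<a> X \<I> Y = \<r> X \<otimes>\<^sub>m idn Y"

text \<open>The two hexagons are \<open>c\<^bsub>X\<otimes>Y,Z\<^esub> = (c\<^bsub>X,Z\<^esub> \<otimes> Y)(X \<otimes> c\<^bsub>Y,Z\<^esub>)\<close> and
  \<open>c\<^bsub>X,Y\<otimes>Z\<^esub> = (Y \<otimes> c\<^bsub>X,Z\<^esub>)(c\<^bsub>X,Y\<^esub> \<otimes> Z)\<close> with the associativity constraints inserted.\<close>

locale braided_monoidal_category = monoidal_category +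
  assumes braid_hom: "X \<in> Obj M \<Longrightarrow> Y \<in> Obj M \<Longrightarrow> \<c> X Y \<in> Hom (X \<otimes>\<^sub>o Y) (Y \<otimes>\<^sub>o X)"
    and braid_iso: "X \<in> Obj M \<Longrightarrow> Y \<in> Obj M \<Longrightarrow> isomorphism M (\<c> X Y)"
    and braid_natural: "f \<in> Hom X X' \<Longrightarrow> g \<in> Hom Y Y'
      \<Longrightarrow> \<c> X' Y' \<cdot> (f \<otimes>\<^sub>m g) = (g \<otimes>\<^sub>m f) \<cdot> \<c> X Y"
    and hexagon_left: "X \<in> Obj M \<Longrightarrow> Y \<in> Obj M \<Longrightarrow> Z \<in> Obj M
      \<Longrightarrow> \<c> (X \<otimes>\<^sub>o Y) Z = \<a> Z X Y \<cdot> (\<c> X Z \<otimes>\<^sub>m idn Y) \<cdot> inv_arr M (\<a> X Z Y)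
                            \<cdot> (idn X \<otimes>\<^sub>m \<c> Y Z) \<cdot> \<a> X Y Z"
    and hexagon_right: "X \<in> Obj M \<Longrightarrow> Y \<in> Obj M \<Longrightarrow> Z \<in> Obj M
      \<Longrightarrow> \<c> X (Y \<otimes>\<^sub>o Z) = inv_arr M (\<a> Y Z X) \<cdot> (idn Y \<otimes>\<^sub>m \<c> X Z) \<cdot> \<a> Y X Z
                            \<cdot> (\<c> X Y \<otimes>\<^sub>m idn Z) \<cdot> inv_arr M (\<a> X Y Z)"

locale abelian_coabelian_braided_monoidal_category =
  abelian_category M + braided_monoidal_category M
  for M :: "('o, 'm, 'x) braided_monoidal_scheme" (structure) +
  assumes tens_left_additive: "X \<in> Obj M \<Longrightarrow> additive_on_arrows M (\<lambda>f. idn X \<otimes>\<^sub>m f)"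
    and tens_right_additive: "X \<in> Obj M \<Longrightarrow> additive_on_arrows M (\<lambda>f. f \<otimes>\<^sub>m idn X)"
    and tens_left_right_exact: "X \<in> Obj M \<Longrightarrow> right_exact M (\<lambda>f. idn X \<otimes>\<^sub>m f)"
    and tens_right_right_exact: "X \<in> Obj M \<Longrightarrow> right_exact M (\<lambda>f. f \<otimes>\<^sub>m idn X)"
    and tens_left_left_exact: "X \<in> Obj M \<Longrightarrow> left_exact M (\<lambda>f. idn X \<otimes>\<^sub>m f)"
    and tens_right_left_exact: "X \<in> Obj M \<Longrightarrow> left_exact M (\<lambda>f. f \<otimes>\<^sub>m idn X)"


section \<open>Suppressing the associativity constraints\<close>

text \<open>A word \<open>[X\<^sub>1, \<dots>, X\<^sub>n]\<close> of objects stands for \<open>X\<^sub>1 \<otimes> (X\<^sub>2 \<otimes> (\<dots> \<otimes> X\<^sub>n))\<close>, and a morphism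
  between such products is kept together with its source and target word. Tensoring these
  morphisms concatenates the words; the associativity constraints (and, for empty words,
  the unit constraints) that reparenthesise the tensor product are inserted by
  \<open>join\<close>. Thus a formula with suppressed associativity constraints can be
  written down literally, without assuming that the monoidal category is strict.\<close>

datatype ('o, 'm) word_arrow = Word_arrow (wsrc: "'o list") (warr: 'm) (wtgt: "'o list")

context
  fixes M :: "('o, 'm, 'x) braided_monoidal_scheme" (structure)
begin

fun word_tensor :: "'o list \<Rightarrow> 'o" where
  "word_tensor [] = \<I>"
| "word_tensor [X] = X"
| "word_tensor (X # Y # xs) = X \<otimes>\<^sub>o word_tensor (Y # xs)"

text \<open>\<open>join xs ys : word_tensor xs \<otimes> word_tensor ys \<rightarrow> word_tensor (xs @ ys)\<close> is the canonical
  isomorphism.\<close>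

fun join :: "'o list \<Rightarrow> 'o list \<Rightarrow> 'm" where
  "join [] ys = \<l> (word_tensor ys)"
| "join [X] ys = (if ys = [] then \<r> X else idn (X \<otimes>\<^sub>o word_tensor ys))"
| "join (X # Y # xs) ys =
     (idn X \<otimes>\<^sub>m join (Y # xs) ys) \<cdot> \<a> X (word_tensor (Y # xs)) (word_tensor ys)"

definition wire :: "'o \<Rightarrow> ('o, 'm) word_arrow" where
  "wire X = Word_arrow [X] (idn X) [X]"

text \<open>The composite is only meaningful if \<open>wtgt f = wsrc g\<close>.\<close>

definition wcomp :: "('o, 'm) word_arrow \<Rightarrow> ('o, 'm) word_arrow \<Rightarrow> ('o, 'm) word_arrow" where
  "wcomp g f = Word_arrow (wsrc f) (warr g \<cdot> warr f) (wtgt g)"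

definition wtens :: "('o, 'm) word_arrow \<Rightarrow> ('o, 'm) word_arrow \<Rightarrow> ('o, 'm) word_arrow" where
  "wtens f g = Word_arrow (wsrc f @ wsrc g)
     (join (wtgt f) (wtgt g) \<cdot> (warr f \<otimes>\<^sub>m warr g) \<cdot> inv_arr M (join (wsrc f) (wsrc g)))
     (wtgt f @ wtgt g)"

definition wbraid :: "'o \<Rightarrow> 'o \<Rightarrow> ('o, 'm) word_arrow" where
  "wbraid X Y = Word_arrow [X, Y] (\<c> X Y) [Y, X]"

end

notation wcomp (infixr "\<odot>\<index>" 55)
notation wtens (infixr "\<boxtimes>\<index>" 70)


section \<open>Bialgebras in a braided monoidal category\<close>

record ('o, 'm) bialg =
  bob :: 'o
  bmul :: 'm
  bunit :: 'm
  bcomul :: 'm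
  bcounit :: 'm

context
  fixes M :: "('o, 'm, 'x) braided_monoidal_scheme" (structure)
begin

text \<open>The canonical isomorphism \<open>1 \<otimes> 1 \<rightarrow> 1\<close>; it is also \<open>\<r> \<I>\<close>.\<close>

definition m_unit :: 'm where "m_unit = \<l> \<I>"

definition \<Delta>_unit :: 'm where "\<Delta>_unit = inv_arr M m_unit"

definition is_algebra :: "'o \<Rightarrow> 'm \<Rightarrow> 'm \<Rightarrow> bool" where
  "is_algebra X m u \<longleftrightarrow> X \<in> Obj M \<and> m \<in> Hom (X \<otimes>\<^sub>o X) X \<and> u \<in> Hom \<I> X \<and>
    m \<cdot> (m \<otimes>\<^sub>m idn X) = m \<cdot> (idn X \<otimes>\<^sub>m m) \<cdot> \<a> X X X \<and>
    m \<cdot> (u \<otimes>\<^sub>m idn X) = \<l> X \<and> m \<cdot> (idn X \<otimes>\<^sub>m u) = \<r> X"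

definition is_coalgebra :: "'o \<Rightarrow> 'm \<Rightarrow> 'm \<Rightarrow> bool" where
  "is_coalgebra X \<Delta> \<epsilon> \<longleftrightarrow> X \<in> Obj M \<and> \<Delta> \<in> Hom X (X \<otimes>\<^sub>o X) \<and> \<epsilon> \<in> Hom X \<I> \<and>
    \<a> X X X \<cdot> (\<Delta> \<otimes>\<^sub>m idn X) \<cdot> \<Delta> = (idn X \<otimes>\<^sub>m \<Delta>) \<cdot> \<Delta> \<and>
    \<l> X \<cdot> (\<epsilon> \<otimes>\<^sub>m idn X) \<cdot> \<Delta> = idn X \<and> \<r> X \<cdot> (idn X \<otimes>\<^sub>m \<epsilon>) \<cdot> \<Delta> = idn X"

definition is_algebra_hom :: "'o \<Rightarrow> 'm \<Rightarrow> 'm \<Rightarrow> 'o \<Rightarrow> 'm \<Rightarrow> 'm \<Rightarrow> 'm \<Rightarrow> bool" where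
  "is_algebra_hom X m\<^sub>X u\<^sub>X Y m\<^sub>Y u\<^sub>Y f \<longleftrightarrow>
    f \<in> Hom X Y \<and> f \<cdot> m\<^sub>X = m\<^sub>Y \<cdot> (f \<otimes>\<^sub>m f) \<and> f \<cdot> u\<^sub>X = u\<^sub>Y"

definition is_coalgebra_hom :: "'o \<Rightarrow> 'm \<Rightarrow> 'm \<Rightarrow> 'o \<Rightarrow> 'm \<Rightarrow> 'm \<Rightarrow> 'm \<Rightarrow> bool" where
  "is_coalgebra_hom X \<Delta>\<^sub>X \<epsilon>\<^sub>X Y \<Delta>\<^sub>Y \<epsilon>\<^sub>Y f \<longleftrightarrow>
    f \<in> Hom X Y \<and> \<Delta>\<^sub>Y \<cdot> f = (f \<otimes>\<^sub>m f) \<cdot> \<Delta>\<^sub>X \<and> \<epsilon>\<^sub>Y \<cdot> f = \<epsilon>\<^sub>X"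

definition is_bialgebra :: "('o, 'm) bialg \<Rightarrow> bool" where
  "is_bialgebra H \<longleftrightarrow>
    is_algebra (bob H) (bmul H) (bunit H) \<and> is_coalgebra (bob H) (bcomul H) (bcounit H) \<and>
    (let X = bob H;
         m = Word_arrow [X, X] (bmul H) [X];
         \<Delta> = Word_arrow [X] (bcomul H) [X, X]
     in \<Delta> \<odot> m = (m \<boxtimes> m) \<odot> (wire M X \<boxtimes> wbraid M X X \<boxtimes> wire M X) \<odot> (\<Delta> \<boxtimes> \<Delta>)) \<and>
    bcounit H \<cdot> bmul H = m_unit \<cdot> (bcounit H \<otimes>\<^sub>m bcounit H) \<and>
    bcomul H \<cdot> bunit H = (bunit H \<otimes>\<^sub>m bunit H) \<cdot> \<Delta>_unit \<and>
    bcounit H \<cdot> bunit H = idn \<I>"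

definition is_antipode :: "('o, 'm) bialg \<Rightarrow> 'm \<Rightarrow> bool" where
  "is_antipode H S \<longleftrightarrow> S \<in> Hom (bob H) (bob H) \<and>
    bmul H \<cdot> (S \<otimes>\<^sub>m idn (bob H)) \<cdot> bcomul H = bunit H \<cdot> bcounit H \<and>
    bmul H \<cdot> (idn (bob H) \<otimes>\<^sub>m S) \<cdot> bcomul H = bunit H \<cdot> bcounit H"

definition is_sub_bialgebra :: "('o, 'm) bialg \<Rightarrow> ('o, 'm) bialg \<Rightarrow> 'm \<Rightarrow> bool" where
  "is_sub_bialgebra B A \<sigma> \<longleftrightarrow> is_bialgebra A \<and> is_bialgebra B \<and>
    is_algebra_hom (bob B) (bmul B) (bunit B) (bob A) (bmul A) (bunit A) \<sigma> \<and>
    is_coalgebra_hom (bob B) (bcomul B) (bcounit B) (bob A) (bcomul A) (bcounit A) \<sigma> \<and>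
    monomorphism M \<sigma>"

definition is_right_weak_projection ::
    "('o, 'm) bialg \<Rightarrow> ('o, 'm) bialg \<Rightarrow> 'm \<Rightarrow> 'm \<Rightarrow> bool" where
  "is_right_weak_projection A B \<sigma> \<pi> \<longleftrightarrow>
    is_coalgebra_hom (bob A) (bcomul A) (bcounit A) (bob B) (bcomul B) (bcounit B) \<pi> \<and>
    \<pi> \<cdot> bmul A \<cdot> (idn (bob A) \<otimes>\<^sub>m \<sigma>) = bmul B \<cdot> (\<pi> \<otimes>\<^sub>m idn (bob B)) \<and>
    \<pi> \<cdot> \<sigma> = idn (bob B)"

definition transported_bialgebra ::
    "('o, 'm) bialg \<Rightarrow> 'o \<Rightarrow> 'm \<Rightarrow> 'm \<Rightarrow> ('o, 'm) bialg" where
  "transported_bialgebra A X \<phi> \<psi> =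
    \<lparr>bob = X,
     bmul = \<psi> \<cdot> bmul A \<cdot> (\<phi> \<otimes>\<^sub>m \<phi>),
     bunit = \<psi> \<cdot> bunit A,
     bcomul = (\<psi> \<otimes>\<^sub>m \<psi>) \<cdot> bcomul A \<cdot> \<phi>,
     bcounit = bcounit A \<cdot> \<phi>\<rparr>"

text \<open>The displayed words have source \<open>[R, B, R, B]\<close>, resp. target \<open>[R, B, R, B]\<close>; the outer
  associativity constraint passes between \<open>R \<otimes> (B \<otimes> (R \<otimes> B))\<close> and \<open>(R \<otimes> B) \<otimes> (R \<otimes> B)\<close>.\<close>

definition cross_product_bialgebra ::
    "('o, 'm) bialg \<Rightarrow> 'o \<Rightarrow> 'm \<Rightarrow> 'm \<Rightarrow> 'm \<Rightarrow> 'm \<Rightarrow> 'm \<Rightarrow> 'm \<Rightarrow> 'm \<Rightarrow> 'm \<Rightarrow> ('o, 'm) bialg" where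
  "cross_product_bialgebra B R m\<^sub>R u\<^sub>R \<Delta>\<^sub>R \<epsilon>\<^sub>R \<xi> \<mu>\<^sub>R \<rho>\<^sub>R \<mu>\<^sub>B =
   (let b = bob B;
        wR = wire M R;
        wB = wire M b;
        mB = Word_arrow [b, b] (bmul B) [b];
        DB = Word_arrow [b] (bcomul B) [b, b];
        mR = Word_arrow [R, R] m\<^sub>R [R];
        DR = Word_arrow [R] \<Delta>\<^sub>R [R, R];
        x = Word_arrow [R, R] \<xi> [b];
        lR = Word_arrow [b, R] \<mu>\<^sub>R [R];
        dR = Word_arrow [R] \<rho>\<^sub>R [b, R];
        rB = Word_arrow [b, R] \<mu>\<^sub>B [b]
    in
    \<lparr>bob = R \<otimes>\<^sub>o b,
     bmul = warr
       ((wR \<boxtimes> mB)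
        \<odot> (mR \<boxtimes> x \<boxtimes> wB)
        \<odot> (wR \<boxtimes> lR \<boxtimes> wR \<boxtimes> wR \<boxtimes> mB)
        \<odot> (wR \<boxtimes> wB \<boxtimes> wbraid M R R \<boxtimes> wR \<boxtimes> wB \<boxtimes> wB)
        \<odot> (wR \<boxtimes> dR \<boxtimes> wR \<boxtimes> wR \<boxtimes> wB \<boxtimes> wB)
        \<odot> (DR \<boxtimes> DR \<boxtimes> wB \<boxtimes> wB)
        \<odot> (wR \<boxtimes> lR \<boxtimes> rB \<boxtimes> wB)
        \<odot> (wR \<boxtimes> wB \<boxtimes> wbraid M b R \<boxtimes> wR \<boxtimes> wB)
        \<odot> (wR \<boxtimes> DB \<boxtimes> DR \<boxtimes> wB)) \<cdot> \<a> R b (R \<otimes>\<^sub>o b),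
     bunit = (u\<^sub>R \<otimes>\<^sub>m bunit B) \<cdot> \<Delta>_unit,
     bcomul = inv_arr M (\<a> R b (R \<otimes>\<^sub>o b)) \<cdot> warr
       ((wR \<boxtimes> mB \<boxtimes> wR \<boxtimes> wB)
        \<odot> (wR \<boxtimes> wB \<boxtimes> wbraid M R b \<boxtimes> wB)
        \<odot> (wR \<boxtimes> dR \<boxtimes> wB \<boxtimes> wB)
        \<odot> (DR \<boxtimes> DB)),
     bcounit = m_unit \<cdot> (\<epsilon>\<^sub>R \<otimes>\<^sub>m bcounit B)\<rparr>)"

end

end

theory Submission imports Defs begin

text \<open>
  Write \<open>\<phi> = m\<^sub>A(i \<otimes> \<sigma>) : R \<otimes> B \<rightarrow> A\<close> and \<open>\<psi> = (p \<otimes> \<pi>)\<Delta>\<^sub>A : A \<rightarrow> R \<otimes> B\<close>. In Sweedler notation,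
  with crossings suppressed,
  \<open>\<phi>\<psi>(x) = x\<^sub>1 \<sigma>S\<pi>(x\<^sub>2) \<sigma>\<pi>(x\<^sub>3) = x\<close>, because \<open>\<pi>\<close> respects comultiplication, \<open>\<sigma>\<close> respects
  multiplication, and \<open>S\<close> is an antipode (\<open>\<phi>_\<psi>\<close>). Conversely, the equalizer condition
  \<open>r\<^sub>1 \<otimes> \<pi>(r\<^sub>2) = r \<otimes> 1\<close> and the right linearity of \<open>\<pi>\<close> make \<open>\<phi>\<close> a map of right \<open>B\<close>-comodules
  (\<open>coaction_\<phi>\<close>); hence \<open>\<Pi>\<^sub>2\<phi>(r \<otimes> b) = r b\<^sub>1 \<sigma>S(b\<^sub>2) = r \<epsilon>(b)\<close>, which says that \<open>p\<phi> = R \<otimes> \<epsilon>\<^sub>B\<close>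
  (\<open>p_\<phi>\<close>), and \<open>\<psi>\<phi> = id\<close> follows (\<open>\<psi>_\<phi>\<close>). From
  here on, every statement about \<open>p\<close> on all of \<open>A\<close> is tested on the products \<open>\<phi>(r \<otimes> b)\<close>, where
  \<open>p\<close> is known.

  Three consequences carry the rest. First, \<open>p(x \<sigma>(b)) = p(x) \<epsilon>(b)\<close> (\<open>p_mul_sub\<close>), and therefore
  \<open>(p \<otimes> p)\<Delta>\<close> does not see right multiplication by \<open>B\<close> either, so that \<open>p\<close> is a coalgebra map onto
  \<open>R\<close> (\<open>comul_p\<close>); coassociativity and counit of \<open>R\<close> are then inherited from \<open>A\<close>. Second,
  \<open>\<psi>(x \<sigma>(b)) = \<psi>(x) b\<close> (\<open>\<psi>_mul_sub\<close>). Third, the projection \<open>\<Pi>\<^sub>2 = ip\<close> is absorbed both by \<open>\<Delta>i\<close>,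
  on the right leg (\<open>comul_incl_coinv\<close>), and by \<open>p m\<close>, on the right factor (\<open>p_mul_incl_coinv\<close>).
  With these rules the structure transported from \<open>A\<close> unfolds to the cross product formulas. For
  the multiplication, the product \<open>\<phi>(r \<otimes> b) \<phi>(s \<otimes> c)\<close> is reassociated to \<open>r (b s) c\<close>; the inner
  product \<open>b s\<close> is written as \<open>\<phi>\<psi>(b s)\<close>, which produces the first half of the formula
  (\<open>cross_mul_left\<close>), and \<open>\<psi>\<close> of the product of two elements of \<open>R\<close> produces the second half
  (\<open>cross_mul_right\<close>).

  The computations are string diagrams, so they are carried out in a strict category. The word
  arrows form a strict monoidal category, because the canonical isomorphisms \<open>join\<close> are coherent
  (\<open>join_join\<close>, \<open>join_Nil_right\<close>). There two diagrams that differ by sliding generators past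
  one another are equal, and the simplifier verifies this by rewriting both to a common form, a
  composite of layers with one generator each (rule \<open>planarI\<close> with the rewrite rules \<open>planar\<close>). A calculation therefore
  alternates between two kinds of step: a regrouping, which exhibits the left side of an axiom as a
  subdiagram, and the replacement of this subdiagram. Generators pass
  through crossings by naturality, and a crossing with a unit or a counit disappears, because the
  braiding with the unit object is trivial.
\<close>

section \<open>Arrows and isomorphisms in a category\<close>

context category begin

text \<open>Typing by source and target functions lets the simplifier check composability by rewriting;
  the hom-set form of the axioms would leave the middle object to be guessed.\<close>

lemma hom_iff: "f \<in> Hom X Y \<longleftrightarrow> f \<in> Arr C \<and> Dom C f = X \<and> Cod C f = Y"
  by (simp add: arrows_def)

lemma comp_typing [simp]:
  assumes "f \<in> Arr C" "g \<in> Arr C" "Cod C f = Dom C g"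
  shows "g \<cdot> f \<in> Arr C" "Dom C (g \<cdot> f) = Dom C f" "Cod C (g \<cdot> f) = Cod C g"
  using comp_hom[of f "Dom C f" "Dom C g" g "Cod C g"] assms by (simp_all add: hom_iff)

lemma idn_typing [simp]:
  assumes "X \<in> Obj C"
  shows "idn X \<in> Arr C" "Dom C (idn X) = X" "Cod C (idn X) = X"
  using id_hom[OF assms] by (simp_all add: hom_iff)

lemma comp_idn [simp]:
  assumes "f \<in> Arr C"
  shows "Dom C f = X \<Longrightarrow> f \<cdot> idn X = f" "Cod C f = X \<Longrightarrow> idn X \<cdot> f = f"
  using id_right[of f] id_left[of f] assms by (auto simp: hom_iff)

lemma comp_assoc_simp [simp]:
  assumes "f \<in> Arr C" "g \<in> Arr C" "h \<in> Arr C" "Cod C f = Dom C g" "Cod C g = Dom C h"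
  shows "(h \<cdot> g) \<cdot> f = h \<cdot> (g \<cdot> f)"
  using comp_assoc[of f "Dom C f" "Dom C g" g "Dom C h" h "Cod C h"] assms by (simp add: hom_iff)

declare dom_obj [simp] cod_obj [simp]

lemma inverse_arrows_unique:
  assumes "inverse_arrows C f g" "inverse_arrows C f h" shows "g = h"
proof -
  have "g \<cdot> (f \<cdot> h) = (g \<cdot> f) \<cdot> h"
    using assms by (subst comp_assoc_simp) (auto simp: inverse_arrows_def hom_iff)
  then show ?thesis using assms by (auto simp: inverse_arrows_def hom_iff)
qed

lemma inv_arr_eqI: "inverse_arrows C f g \<Longrightarrow> inv_arr C f = g"
  unfolding inv_arr_def using inverse_arrows_unique by blast

lemma inverse_arrows_inv_arr: "isomorphism C f \<Longrightarrow> inverse_arrows C f (inv_arr C f)"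
  unfolding isomorphism_def using inv_arr_eqI by auto

lemma inv_arr_typing [simp]:
  assumes "isomorphism C f"
  shows "inv_arr C f \<in> Arr C" "Dom C (inv_arr C f) = Cod C f" "Cod C (inv_arr C f) = Dom C f"
  using inverse_arrows_inv_arr[OF assms] by (simp_all add: inverse_arrows_def hom_iff)

lemma iso_arr: "isomorphism C f \<Longrightarrow> f \<in> Arr C"
  by (auto simp: isomorphism_def inverse_arrows_def)

lemma inv_arr_comp [simp]:
  assumes "isomorphism C f"
  shows "Dom C f = X \<Longrightarrow> inv_arr C f \<cdot> f = idn X" "Cod C f = X \<Longrightarrow> f \<cdot> inv_arr C f = idn X"
  using inverse_arrows_inv_arr[OF assms] by (simp_all add: inverse_arrows_def)

lemma inv_arr_cancel [simp]:
  assumes "isomorphism C f" "g \<in> Arr C"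
  shows "Cod C g = Dom C f \<Longrightarrow> inv_arr C f \<cdot> (f \<cdot> g) = g"
    and "Cod C g = Cod C f \<Longrightarrow> f \<cdot> (inv_arr C f \<cdot> g) = g"
  using assms iso_arr[OF assms(1)] by (simp_all flip: comp_assoc_simp)

lemma iso_idn [simp]: "X \<in> Obj C \<Longrightarrow> isomorphism C (idn X)"
  unfolding isomorphism_def inverse_arrows_def by (rule exI[of _ "idn X"]) (simp add: hom_iff)

lemma inv_arr_idn [simp]: "X \<in> Obj C \<Longrightarrow> inv_arr C (idn X) = idn X"
  by (rule inv_arr_eqI) (simp add: inverse_arrows_def hom_iff)

lemma inverse_arrows_comp:
  assumes "inverse_arrows C f f'" "inverse_arrows C g g'" "Cod C f = Dom C g"
  shows "inverse_arrows C (g \<cdot> f) (f' \<cdot> g')"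
proof -
  have [simp]: "f \<in> Arr C" "f' \<in> Arr C" "g \<in> Arr C" "g' \<in> Arr C" "Dom C f' = Cod C f"
    "Dom C g' = Cod C g" "Cod C f' = Dom C f" "Cod C g' = Dom C g"
    using assms by (auto simp: inverse_arrows_def hom_iff)
  have [simp]: "g' \<cdot> (g \<cdot> f) = f" "f \<cdot> (f' \<cdot> g') = g'"
    using assms by (simp_all add: inverse_arrows_def flip: comp_assoc_simp)
  show ?thesis using assms by (simp add: inverse_arrows_def hom_iff)
qed

lemma iso_comp [simp]:
  "isomorphism C f \<Longrightarrow> isomorphism C g \<Longrightarrow> Cod C f = Dom C g \<Longrightarrow> isomorphism C (g \<cdot> f)"
  using inverse_arrows_comp unfolding isomorphism_def by blast

lemma iso_cancel_right:
  assumes "isomorphism C k" "f \<in> Arr C" "g \<in> Arr C" "Dom C f = Cod C k" "Dom C g = Cod C k"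
    "f \<cdot> k = g \<cdot> k"
  shows "f = g"
proof -
  have "f = (f \<cdot> k) \<cdot> inv_arr C k" using assms(1-5) iso_arr[of k] by simp
  also have "\<dots> = g" using assms(1-5) iso_arr[of k] unfolding assms(6) by simp
  finally show ?thesis .
qed

lemma iso_cancel_left:
  assumes "isomorphism C k" "f \<in> Arr C" "g \<in> Arr C" "Cod C f = Dom C k" "Cod C g = Dom C k"
    "k \<cdot> f = k \<cdot> g"
  shows "f = g"
proof -
  have "f = inv_arr C k \<cdot> (k \<cdot> f)" using assms(1-5) iso_arr[of k] by simp
  also have "\<dots> = g" using assms(1-5) iso_arr[of k] unfolding assms(6) by simp
  finally show ?thesis .
qed

end

section \<open>Coherence in monoidal and braided categories\<close>

context monoidal_category begin

declare unit_obj [simp] tens_obj [simp] tens_id [simp] assoc_iso [simp] lunit_iso [simp] runit_iso [simp]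

lemma tens_typing [simp]:
  assumes "f \<in> Arr M" "g \<in> Arr M"
  shows "f \<otimes>\<^sub>m g \<in> Arr M" "Dom M (f \<otimes>\<^sub>m g) = Dom M f \<otimes>\<^sub>o Dom M g"
    "Cod M (f \<otimes>\<^sub>m g) = Cod M f \<otimes>\<^sub>o Cod M g"
  using tens_hom[of f "Dom M f" "Cod M f" g "Dom M g" "Cod M g"] assms by (simp_all add: hom_iff)

lemma assoc_typing [simp]:
  assumes "X \<in> Obj M" "Y \<in> Obj M" "Z \<in> Obj M"
  shows "\<a> X Y Z \<in> Arr M" "Dom M (\<a> X Y Z) = (X \<otimes>\<^sub>o Y) \<otimes>\<^sub>o Z" "Cod M (\<a> X Y Z) = X \<otimes>\<^sub>o (Y \<otimes>\<^sub>o Z)"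
  using assoc_hom[OF assms] by (simp_all add: hom_iff)

lemma lunit_typing [simp]:
  assumes "X \<in> Obj M"
  shows "\<l> X \<in> Arr M" "Dom M (\<l> X) = \<I> \<otimes>\<^sub>o X" "Cod M (\<l> X) = X"
  using lunit_hom[OF assms] by (simp_all add: hom_iff)

lemma runit_typing [simp]:
  assumes "X \<in> Obj M"
  shows "\<r> X \<in> Arr M" "Dom M (\<r> X) = X \<otimes>\<^sub>o \<I>" "Cod M (\<r> X) = X"
  using runit_hom[OF assms] by (simp_all add: hom_iff)

lemma interchange:
  assumes "f \<in> Arr M" "g \<in> Arr M" "f' \<in> Arr M" "g' \<in> Arr M" "Cod M f = Dom M g" "Cod M f' = Dom M g'"
  shows "(g \<otimes>\<^sub>m g') \<cdot> (f \<otimes>\<^sub>m f') = (g \<cdot> f) \<otimes>\<^sub>m (g' \<cdot> f')"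
  using tens_comp[of f "Dom M f" "Dom M g" g "Cod M g" f' "Dom M f'" "Dom M g'" g' "Cod M g'"] assms
  by (simp add: hom_iff)

text \<open>Composites are kept nested to the right, so every two-arrow rewrite rule needs a second
  version in which the composite continues.\<close>

lemma interchange_tail:
  assumes "f \<in> Arr M" "g \<in> Arr M" "f' \<in> Arr M" "g' \<in> Arr M" "Cod M f = Dom M g" "Cod M f' = Dom M g'"
    "k \<in> Arr M" "Cod M k = Dom M f \<otimes>\<^sub>o Dom M f'"
  shows "(g \<otimes>\<^sub>m g') \<cdot> ((f \<otimes>\<^sub>m f') \<cdot> k) = ((g \<cdot> f) \<otimes>\<^sub>m (g' \<cdot> f')) \<cdot> k"
  using assms by (simp flip: comp_assoc_simp add: interchange)

lemma assoc_nat: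
  assumes "f \<in> Arr M" "g \<in> Arr M" "h \<in> Arr M" "Cod M f = X" "Cod M g = Y" "Cod M h = Z"
  shows "\<a> X Y Z \<cdot> ((f \<otimes>\<^sub>m g) \<otimes>\<^sub>m h)
    = (f \<otimes>\<^sub>m (g \<otimes>\<^sub>m h)) \<cdot> \<a> (Dom M f) (Dom M g) (Dom M h)"
  using assoc_natural[of f "Dom M f" X g "Dom M g" Y h "Dom M h" Z] assms by (simp add: hom_iff)

lemma assoc_nat_tail:
  assumes "f \<in> Arr M" "g \<in> Arr M" "h \<in> Arr M" "Cod M f = X" "Cod M g = Y" "Cod M h = Z"
    "k \<in> Arr M" "Cod M k = (Dom M f \<otimes>\<^sub>o Dom M g) \<otimes>\<^sub>o Dom M h"
  shows "\<a> X Y Z \<cdot> ((f \<otimes>\<^sub>m g) \<otimes>\<^sub>m h) \<cdot> k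
    = (f \<otimes>\<^sub>m (g \<otimes>\<^sub>m h)) \<cdot> \<a> (Dom M f) (Dom M g) (Dom M h) \<cdot> k"
proof -
  have "(\<a> X Y Z \<cdot> ((f \<otimes>\<^sub>m g) \<otimes>\<^sub>m h)) \<cdot> k
    = ((f \<otimes>\<^sub>m (g \<otimes>\<^sub>m h)) \<cdot> \<a> (Dom M f) (Dom M g) (Dom M h)) \<cdot> k"
    using assms by (simp only: assoc_nat)
  then show ?thesis using assms by auto
qed

lemma lunit_nat: "f \<in> Arr M \<Longrightarrow> Cod M f = Y \<Longrightarrow> \<l> Y \<cdot> (idn \<I> \<otimes>\<^sub>m f) = f \<cdot> \<l> (Dom M f)"
  using lunit_natural[of f "Dom M f" Y] by (simp add: hom_iff)

lemma runit_nat: "f \<in> Arr M \<Longrightarrow> Cod M f = Y \<Longrightarrow> \<r> Y \<cdot> (f \<otimes>\<^sub>m idn \<I>) = f \<cdot> \<r> (Dom M f)"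
  using runit_natural[of f "Dom M f" Y] by (simp add: hom_iff)

lemma inverse_arrows_tens:
  "inverse_arrows M f f' \<Longrightarrow> inverse_arrows M g g' \<Longrightarrow> inverse_arrows M (f \<otimes>\<^sub>m g) (f' \<otimes>\<^sub>m g')"
  by (auto simp: inverse_arrows_def hom_iff interchange)

lemma iso_tens [simp]: "isomorphism M f \<Longrightarrow> isomorphism M g \<Longrightarrow> isomorphism M (f \<otimes>\<^sub>m g)"
  using inverse_arrows_tens unfolding isomorphism_def by blast

text \<open>The unit constraints are natural isomorphisms from tensoring with the unit object to the
  identity functor, which is faithful.\<close>

lemma unit_tens_faithful:
  assumes "f \<in> Arr M" "g \<in> Arr M" "Dom M f = Dom M g" "Cod M f = Cod M g"
    "idn \<I> \<otimes>\<^sub>m f = idn \<I> \<otimes>\<^sub>m g"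
  shows "f = g"
proof (rule iso_cancel_right[of "\<l> (Dom M f)"])
  show "f \<cdot> \<l> (Dom M f) = g \<cdot> \<l> (Dom M f)"
    using lunit_nat[of f "Cod M f"] lunit_nat[of g "Cod M g"] assms by metis
qed (use assms in simp_all)

lemma tens_unit_faithful:
  assumes "f \<in> Arr M" "g \<in> Arr M" "Dom M f = Dom M g" "Cod M f = Cod M g"
    "f \<otimes>\<^sub>m idn \<I> = g \<otimes>\<^sub>m idn \<I>"
  shows "f = g"
proof (rule iso_cancel_right[of "\<r> (Dom M f)"])
  show "f \<cdot> \<r> (Dom M f) = g \<cdot> \<r> (Dom M f)"
    using runit_nat[of f "Cod M f"] runit_nat[of g "Cod M g"] assms by metis
qed (use assms in simp_all)

text \<open>Kelly's argument: after tensoring with the unit object, the pentagon for \<open>\<I>, \<I>, X, Y\<close> and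
  the triangle identity turn both sides into the same arrow.\<close>

lemma lunit_tens:
  assumes [simp]: "X \<in> Obj M" "Y \<in> Obj M"
  shows "\<l> (X \<otimes>\<^sub>o Y) \<cdot> \<a> \<I> X Y = \<l> X \<otimes>\<^sub>m idn Y"
proof (rule unit_tens_faithful)
  let ?K = "\<a> \<I> (\<I> \<otimes>\<^sub>o X) Y \<cdot> (\<a> \<I> \<I> X \<otimes>\<^sub>m idn Y)"
  have "(idn \<I> \<otimes>\<^sub>m (\<l> (X \<otimes>\<^sub>o Y) \<cdot> \<a> \<I> X Y)) \<cdot> ?K
      = (idn \<I> \<otimes>\<^sub>m \<l> (X \<otimes>\<^sub>o Y)) \<cdot> (idn \<I> \<otimes>\<^sub>m \<a> \<I> X Y) \<cdot> ?K"
    by (simp add: interchange_tail)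
  also have "\<dots> = (idn \<I> \<otimes>\<^sub>m \<l> (X \<otimes>\<^sub>o Y)) \<cdot> \<a> \<I> \<I> (X \<otimes>\<^sub>o Y) \<cdot> \<a> (\<I> \<otimes>\<^sub>o \<I>) X Y"
    by (simp add: pentagon)
  also have "\<dots> = (\<r> \<I> \<otimes>\<^sub>m (idn X \<otimes>\<^sub>m idn Y)) \<cdot> \<a> (\<I> \<otimes>\<^sub>o \<I>) X Y"
    by (simp add: triangle flip: comp_assoc_simp)
  also have "\<dots> = \<a> \<I> X Y \<cdot> ((\<r> \<I> \<otimes>\<^sub>m idn X) \<otimes>\<^sub>m idn Y)"
    by (simp only: assoc_nat runit_typing idn_typing unit_obj assms)
  also have "\<dots> = \<a> \<I> X Y \<cdot> ((idn \<I> \<otimes>\<^sub>m \<l> X) \<otimes>\<^sub>m idn Y) \<cdot> (\<a> \<I> \<I> X \<otimes>\<^sub>m idn Y)"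
    by (simp add: triangle interchange)
  also have "\<dots> = (idn \<I> \<otimes>\<^sub>m (\<l> X \<otimes>\<^sub>m idn Y)) \<cdot> ?K"
    by (simp add: assoc_nat_tail)
  finally show "idn \<I> \<otimes>\<^sub>m (\<l> (X \<otimes>\<^sub>o Y) \<cdot> \<a> \<I> X Y) = idn \<I> \<otimes>\<^sub>m (\<l> X \<otimes>\<^sub>m idn Y)"
    by (rule iso_cancel_right[rotated 5]) simp_all
qed simp_all

text \<open>The mirror image of the preceding lemma, from the pentagon for \<open>X, Y, \<I>, \<I>\<close>.\<close>

lemma runit_tens:
  assumes [simp]: "X \<in> Obj M" "Y \<in> Obj M"
  shows "(idn X \<otimes>\<^sub>m \<r> Y) \<cdot> \<a> X Y \<I> = \<r> (X \<otimes>\<^sub>o Y)"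
proof (rule tens_unit_faithful)
  have "\<a> X Y \<I> \<cdot> (((idn X \<otimes>\<^sub>m \<r> Y) \<cdot> \<a> X Y \<I>) \<otimes>\<^sub>m idn \<I>)
      = \<a> X Y \<I> \<cdot> ((idn X \<otimes>\<^sub>m \<r> Y) \<otimes>\<^sub>m idn \<I>) \<cdot> (\<a> X Y \<I> \<otimes>\<^sub>m idn \<I>)"
    by (simp add: interchange)
  also have "\<dots> = (idn X \<otimes>\<^sub>m (\<r> Y \<otimes>\<^sub>m idn \<I>)) \<cdot> \<a> X (Y \<otimes>\<^sub>o \<I>) \<I> \<cdot> (\<a> X Y \<I> \<otimes>\<^sub>m idn \<I>)"
    by (simp add: assoc_nat_tail)
  also have "\<dots> = (idn X \<otimes>\<^sub>m (idn Y \<otimes>\<^sub>m \<l> \<I>)) \<cdot> (idn X \<otimes>\<^sub>m \<a> Y \<I> \<I>)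
      \<cdot> \<a> X (Y \<otimes>\<^sub>o \<I>) \<I> \<cdot> (\<a> X Y \<I> \<otimes>\<^sub>m idn \<I>)"
    by (simp add: interchange_tail flip: triangle)
  also have "\<dots> = (idn X \<otimes>\<^sub>m (idn Y \<otimes>\<^sub>m \<l> \<I>)) \<cdot> \<a> X Y (\<I> \<otimes>\<^sub>o \<I>) \<cdot> \<a> (X \<otimes>\<^sub>o Y) \<I> \<I>"
    by (simp add: pentagon)
  also have "\<dots> = \<a> X Y \<I> \<cdot> ((idn X \<otimes>\<^sub>m idn Y) \<otimes>\<^sub>m \<l> \<I>) \<cdot> \<a> (X \<otimes>\<^sub>o Y) \<I> \<I>"
    by (simp add: assoc_nat_tail del: tens_id)
  also have "\<dots> = \<a> X Y \<I> \<cdot> (\<r> (X \<otimes>\<^sub>o Y) \<otimes>\<^sub>m idn \<I>)"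
    by (simp add: triangle)
  finally show "((idn X \<otimes>\<^sub>m \<r> Y) \<cdot> \<a> X Y \<I>) \<otimes>\<^sub>m idn \<I> = \<r> (X \<otimes>\<^sub>o Y) \<otimes>\<^sub>m idn \<I>"
    by (rule iso_cancel_left[rotated 5]) simp_all
qed simp_all

text \<open>Naturality of \<open>\<l>\<close> at \<open>\<l> \<I>\<close> gives \<open>\<l>\<^bsub>\<I>\<otimes>\<I>\<^esub> = \<I> \<otimes> \<l>\<^bsub>\<I>\<^esub>\<close>, which the triangle identity then compares with
  \<open>\<r>\<^bsub>\<I>\<^esub>\<close>.\<close>

lemma lunit_unit: "\<l> \<I> = \<r> \<I>"
proof (rule tens_unit_faithful)
  have "\<l> (\<I> \<otimes>\<^sub>o \<I>) = idn \<I> \<otimes>\<^sub>m \<l> \<I>"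
    by (rule iso_cancel_left[of "\<l> \<I>"]) (simp_all add: lunit_nat)
  then show "\<l> \<I> \<otimes>\<^sub>m idn \<I> = \<r> \<I> \<otimes>\<^sub>m idn \<I>"
    by (simp add: triangle flip: lunit_tens)
qed simp_all

lemma word_tensor_Cons: "xs \<noteq> [] \<Longrightarrow> word_tensor M (X # xs) = X \<otimes>\<^sub>o word_tensor M xs"
  by (cases xs) auto

lemma word_tensor_obj [simp]: "set xs \<subseteq> Obj M \<Longrightarrow> word_tensor M xs \<in> Obj M"
  by (induction xs rule: induct_list012) auto

lemma join_Cons: "xs \<noteq> [] \<Longrightarrow> join M (X # xs) ys =
   (idn X \<otimes>\<^sub>m join M xs ys) \<cdot> \<a> X (word_tensor M xs) (word_tensor M ys)"
  by (cases xs) auto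

lemma join_iso:
  assumes "set xs \<subseteq> Obj M" "set ys \<subseteq> Obj M"
  shows "join M xs ys \<in> Hom (word_tensor M xs \<otimes>\<^sub>o word_tensor M ys) (word_tensor M (xs @ ys))
    \<and> isomorphism M (join M xs ys)"
  using assms(1)
proof (induction xs)
  case Nil
  then show ?case using assms by (simp add: hom_iff)
next
  case (Cons X xs)
  then show ?case using assms
    by (cases "xs = []"; cases "ys = []")
       (auto simp: hom_iff word_tensor_Cons join_Cons simp del: join.simps(3) word_tensor.simps(3))
qed

lemma join_simps [simp]:
  assumes "set xs \<subseteq> Obj M" "set ys \<subseteq> Obj M"
  shows "join M xs ys \<in> Arr M" "Dom M (join M xs ys) = word_tensor M xs \<otimes>\<^sub>o word_tensor M ys"
    "Cod M (join M xs ys) = word_tensor M (xs @ ys)" "isomorphism M (join M xs ys)"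
  using join_iso[OF assms] by (simp_all add: hom_iff)

text \<open>This is where the associativity constraints become invisible: the two ways of joining three
  words agree. The induction step is the pentagon; an empty first word needs Kelly's identity for
  \<open>\<l>\<close>, and a single letter before an empty second word needs the triangle identity.\<close>

lemma join_join:
  assumes "set xs \<subseteq> Obj M" and [simp]: "set ys \<subseteq> Obj M" "set zs \<subseteq> Obj M"
  shows "join M (xs @ ys) zs \<cdot> (join M xs ys \<otimes>\<^sub>m idn (word_tensor M zs))
    = join M xs (ys @ zs) \<cdot> (idn (word_tensor M xs) \<otimes>\<^sub>m join M ys zs)
      \<cdot> \<a> (word_tensor M xs) (word_tensor M ys) (word_tensor M zs)"
  using assms(1)
proof (induction xs)
  case Nil
  have "join M ys zs \<cdot> (\<l> (word_tensor M ys) \<otimes>\<^sub>m idn (word_tensor M zs))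
    = join M ys zs \<cdot> \<l> (word_tensor M ys \<otimes>\<^sub>o word_tensor M zs)
      \<cdot> \<a> \<I> (word_tensor M ys) (word_tensor M zs)"
    by (simp add: lunit_tens)
  also have "\<dots> = \<l> (word_tensor M (ys @ zs)) \<cdot> (idn \<I> \<otimes>\<^sub>m join M ys zs)
      \<cdot> \<a> \<I> (word_tensor M ys) (word_tensor M zs)"
    by (simp add: lunit_nat flip: comp_assoc_simp)
  finally show ?case by simp
next
  case (Cons X xs)
  then have [simp]: "X \<in> Obj M" "set xs \<subseteq> Obj M" by auto
  let ?x = "word_tensor M xs" and ?y = "word_tensor M ys" and ?z = "word_tensor M zs"
  show ?case
  proof (cases "xs = []")
    case True
    show ?thesis
    proof (cases "ys = []")
      case True
      with \<open>xs = []\<close> show ?thesis by (simp add: triangle)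
    next
      case False
      with \<open>xs = []\<close> show ?thesis by (simp add: join_Cons word_tensor_Cons)
    qed
  next
    case False
    have "join M ((X # xs) @ ys) zs \<cdot> (join M (X # xs) ys \<otimes>\<^sub>m idn ?z)
      = (idn X \<otimes>\<^sub>m join M (xs @ ys) zs) \<cdot> \<a> X (word_tensor M (xs @ ys)) ?z
        \<cdot> ((idn X \<otimes>\<^sub>m join M xs ys) \<otimes>\<^sub>m idn ?z) \<cdot> (\<a> X ?x ?y \<otimes>\<^sub>m idn ?z)"
      using False by (simp add: join_Cons interchange del: join.simps(3))
    also have "\<dots> = (idn X \<otimes>\<^sub>m (join M (xs @ ys) zs \<cdot> (join M xs ys \<otimes>\<^sub>m idn ?z)))
        \<cdot> \<a> X (?x \<otimes>\<^sub>o ?y) ?z \<cdot> (\<a> X ?x ?y \<otimes>\<^sub>m idn ?z)"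
      by (simp add: assoc_nat_tail interchange_tail)
    also have "\<dots> = (idn X \<otimes>\<^sub>m (join M xs (ys @ zs) \<cdot> (idn ?x \<otimes>\<^sub>m join M ys zs)))
        \<cdot> (idn X \<otimes>\<^sub>m \<a> ?x ?y ?z) \<cdot> \<a> X (?x \<otimes>\<^sub>o ?y) ?z \<cdot> (\<a> X ?x ?y \<otimes>\<^sub>m idn ?z)"
      using Cons.IH by (simp add: interchange_tail)
    also have "\<dots> = (idn X \<otimes>\<^sub>m join M xs (ys @ zs)) \<cdot> (idn X \<otimes>\<^sub>m (idn ?x \<otimes>\<^sub>m join M ys zs))
        \<cdot> \<a> X ?x (?y \<otimes>\<^sub>o ?z) \<cdot> \<a> (X \<otimes>\<^sub>o ?x) ?y ?z"
      by (simp add: interchange_tail pentagon)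
    also have "\<dots> = (idn X \<otimes>\<^sub>m join M xs (ys @ zs)) \<cdot> \<a> X ?x (word_tensor M (ys @ zs))
        \<cdot> ((idn X \<otimes>\<^sub>m idn ?x) \<otimes>\<^sub>m join M ys zs) \<cdot> \<a> (X \<otimes>\<^sub>o ?x) ?y ?z"
      by (simp add: assoc_nat_tail del: tens_id)
    finally show ?thesis
      using False by (simp add: join_Cons word_tensor_Cons del: join.simps(3) word_tensor.simps(3))
  qed
qed

lemma join_Nil_right: "set xs \<subseteq> Obj M \<Longrightarrow> join M xs [] = \<r> (word_tensor M xs)"
proof (induction xs)
  case Nil
  then show ?case by (simp add: lunit_unit)
next
  case (Cons X xs)
  then show ?case
    by (cases "xs = []") (auto simp: join_Cons word_tensor_Cons runit_tens
          simp del: join.simps(3) word_tensor.simps(3))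
qed

end

context braided_monoidal_category begin

lemma braid_typing [simp]:
  assumes "X \<in> Obj M" "Y \<in> Obj M"
  shows "\<c> X Y \<in> Arr M" "Dom M (\<c> X Y) = X \<otimes>\<^sub>o Y" "Cod M (\<c> X Y) = Y \<otimes>\<^sub>o X"
    "isomorphism M (\<c> X Y)"
  using braid_hom[OF assms] braid_iso[OF assms] by (simp_all add: hom_iff)

lemma braid_nat:
  assumes "f \<in> Arr M" "g \<in> Arr M" "Cod M f = X" "Cod M g = Y"
  shows "\<c> X Y \<cdot> (f \<otimes>\<^sub>m g) = (g \<otimes>\<^sub>m f) \<cdot> \<c> (Dom M f) (Dom M g)"
  using braid_natural[of f "Dom M f" X g "Dom M g" Y] assms by (simp add: hom_iff)

text \<open>The hexagon for \<open>\<I>, \<I>, Z\<close> expresses \<open>\<c>\<^bsub>\<I>\<otimes>\<I>,Z\<^esub>\<close> by two copies of \<open>\<c>\<^bsub>\<I>,Z\<^esub>\<close>, and naturality along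
  \<open>\<l> \<I>\<close> expresses it by one; cancelling the common copy leaves the claim tensored with \<open>\<I>\<close>.\<close>

lemma braid_unit_left:
  assumes [simp]: "Z \<in> Obj M"
  shows "\<r> Z \<cdot> \<c> \<I> Z = \<l> Z"
proof (rule tens_unit_faithful)
  let ?K = "(idn \<I> \<otimes>\<^sub>m \<c> \<I> Z) \<cdot> \<a> \<I> \<I> Z" and ?L = "inv_arr M (\<a> \<I> Z \<I>)"
  have "((\<l> Z \<otimes>\<^sub>m idn \<I>) \<cdot> ?L) \<cdot> ?K = \<l> (Z \<otimes>\<^sub>o \<I>) \<cdot> ?K"
    by (simp flip: lunit_tens)
  also have "\<dots> = \<c> \<I> Z \<cdot> (\<l> \<I> \<otimes>\<^sub>m idn Z)"
    by (simp add: lunit_tens lunit_nat flip: comp_assoc_simp) (simp add: lunit_tens)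
  also have "\<dots> = (idn Z \<otimes>\<^sub>m \<l> \<I>) \<cdot> \<c> (\<I> \<otimes>\<^sub>o \<I>) Z"
    by (simp add: braid_nat)
  also have "\<dots> = ((idn Z \<otimes>\<^sub>m \<l> \<I>) \<cdot> \<a> Z \<I> \<I>) \<cdot> (\<c> \<I> Z \<otimes>\<^sub>m idn \<I>) \<cdot> ?L \<cdot> ?K"
    by (simp add: hexagon_left)
  also have "\<dots> = (((\<r> Z \<cdot> \<c> \<I> Z) \<otimes>\<^sub>m idn \<I>) \<cdot> ?L) \<cdot> ?K"
    by (simp add: triangle del: comp_assoc_simp) (simp add: interchange_tail)
  finally have "((\<l> Z \<otimes>\<^sub>m idn \<I>) \<cdot> ?L) = (((\<r> Z \<cdot> \<c> \<I> Z) \<otimes>\<^sub>m idn \<I>) \<cdot> ?L)"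
    by (rule iso_cancel_right[rotated 5]) simp_all
  then have "((\<l> Z \<otimes>\<^sub>m idn \<I>) \<cdot> ?L) \<cdot> \<a> \<I> Z \<I> = (((\<r> Z \<cdot> \<c> \<I> Z) \<otimes>\<^sub>m idn \<I>) \<cdot> ?L) \<cdot> \<a> \<I> Z \<I>"
    by simp
  then show "(\<r> Z \<cdot> \<c> \<I> Z) \<otimes>\<^sub>m idn \<I> = \<l> Z \<otimes>\<^sub>m idn \<I>" by simp
qed simp_all

lemma braid_unit_right:
  assumes [simp]: "X \<in> Obj M"
  shows "\<l> X \<cdot> \<c> X \<I> = \<r> X"
proof (rule tens_unit_faithful)
  have "\<c> X \<I> \<cdot> (idn X \<otimes>\<^sub>m \<l> \<I>) = (\<l> \<I> \<otimes>\<^sub>m idn X) \<cdot> \<c> X (\<I> \<otimes>\<^sub>o \<I>)"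
    by (simp add: braid_nat)
  also have "\<dots> = \<l> (\<I> \<otimes>\<^sub>o X) \<cdot> (idn \<I> \<otimes>\<^sub>m \<c> X \<I>) \<cdot> \<a> \<I> X \<I>
      \<cdot> (\<c> X \<I> \<otimes>\<^sub>m idn \<I>) \<cdot> inv_arr M (\<a> X \<I> \<I>)"
    by (simp add: hexagon_right flip: lunit_tens)
  also have "\<dots> = (\<l> (\<I> \<otimes>\<^sub>o X) \<cdot> (idn \<I> \<otimes>\<^sub>m \<c> X \<I>)) \<cdot> \<a> \<I> X \<I>
      \<cdot> (\<c> X \<I> \<otimes>\<^sub>m idn \<I>) \<cdot> inv_arr M (\<a> X \<I> \<I>)"
    by simp
  also have "\<dots> = \<c> X \<I> \<cdot> (\<l> (X \<otimes>\<^sub>o \<I>) \<cdot> \<a> \<I> X \<I>) 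
      \<cdot> (\<c> X \<I> \<otimes>\<^sub>m idn \<I>) \<cdot> inv_arr M (\<a> X \<I> \<I>)"
    by (simp add: lunit_nat del: comp_assoc_simp) simp
  also have "\<dots> = \<c> X \<I> \<cdot> ((\<l> X \<cdot> \<c> X \<I>) \<otimes>\<^sub>m idn \<I>) \<cdot> inv_arr M (\<a> X \<I> \<I>)"
    by (simp add: lunit_tens interchange_tail del: comp_assoc_simp)
  finally have "idn X \<otimes>\<^sub>m \<l> \<I> = ((\<l> X \<cdot> \<c> X \<I>) \<otimes>\<^sub>m idn \<I>) \<cdot> inv_arr M (\<a> X \<I> \<I>)"
    by (rule iso_cancel_left[rotated 5]) simp_all
  then have "(idn X \<otimes>\<^sub>m \<l> \<I>) \<cdot> \<a> X \<I> \<I> = (((\<l> X \<cdot> \<c> X \<I>) \<otimes>\<^sub>m idn \<I>) \<cdot> inv_arr M (\<a> X \<I> \<I>)) \<cdot> \<a> X \<I> \<I>"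
    by simp
  then show "(\<l> X \<cdot> \<c> X \<I>) \<otimes>\<^sub>m idn \<I> = \<r> X \<otimes>\<^sub>m idn \<I>"
    by (simp add: triangle)
qed simp_all

end

section \<open>The strict monoidal category of words\<close>

definition wid :: "('o, 'm, 'x) braided_monoidal_scheme \<Rightarrow> 'o list \<Rightarrow> ('o, 'm) word_arrow"
  where "wid M xs = Word_arrow xs (idn\<^bsub>M\<^esub> (word_tensor M xs)) xs"

text \<open>One layer of a string diagram: a single generator with idle wires on both sides.\<close>

definition whisker :: "('o, 'm, 'x) braided_monoidal_scheme
    \<Rightarrow> 'o list \<Rightarrow> ('o, 'm) word_arrow \<Rightarrow> 'o list \<Rightarrow> ('o, 'm) word_arrow"
  where "whisker M xs f ys = (wid M xs \<boxtimes>\<^bsub>M\<^esub> f) \<boxtimes>\<^bsub>M\<^esub> wid M ys"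

text \<open>A word arrow is a record without constraints; the laws of the strict category hold for those
  whose morphism really goes between the products of the two words.\<close>

definition well_typed :: "('o, 'm, 'x) braided_monoidal_scheme \<Rightarrow> ('o, 'm) word_arrow \<Rightarrow> bool"
  where "well_typed M f \<longleftrightarrow> set (wsrc f) \<subseteq> Obj M \<and> set (wtgt f) \<subseteq> Obj M \<and>
    warr f \<in> Hom\<^bsub>M\<^esub> (word_tensor M (wsrc f)) (word_tensor M (wtgt f))"

context monoidal_category begin

abbreviation "wt \<equiv> well_typed M"

lemma wtD:
  assumes "wt f"
  shows "warr f \<in> Arr M" "Dom M (warr f) = word_tensor M (wsrc f)"
    "Cod M (warr f) = word_tensor M (wtgt f)"
  using assms by (auto simp: well_typed_def hom_iff)

lemma wt_objects [simp]:
  assumes "wt f" shows "set (wsrc f) \<subseteq> Obj M" "set (wtgt f) \<subseteq> Obj M"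
  using assms by (auto simp: well_typed_def)

lemma wid_simps [simp]:
  "wsrc (wid M xs) = xs" "wtgt (wid M xs) = xs" "set xs \<subseteq> Obj M \<Longrightarrow> wt (wid M xs)"
  by (simp_all add: wid_def well_typed_def hom_iff del: wt_objects)

lemma wcomp_simps [simp]:
  "wsrc (g \<odot> f) = wsrc f" "wtgt (g \<odot> f) = wtgt g"
  "wt f \<Longrightarrow> wt g \<Longrightarrow> wtgt f = wsrc g \<Longrightarrow> wt (g \<odot> f)"
  by (simp_all add: wcomp_def well_typed_def hom_iff del: wt_objects)

lemma wtens_simps [simp]:
  "wsrc (f \<boxtimes> g) = wsrc f @ wsrc g" "wtgt (f \<boxtimes> g) = wtgt f @ wtgt g"
  "wt f \<Longrightarrow> wt g \<Longrightarrow> wt (f \<boxtimes> g)"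
  by (simp_all add: wtens_def well_typed_def hom_iff del: wt_objects)

lemma wcomp_assoc [simp]:
  "wt f \<Longrightarrow> wt g \<Longrightarrow> wt h \<Longrightarrow> wtgt f = wsrc g \<Longrightarrow> wtgt g = wsrc h
    \<Longrightarrow> (h \<odot> g) \<odot> f = h \<odot> (g \<odot> f)"
  by (simp add: wcomp_def wtD)

lemma wcomp_wid [simp]:
  "wt f \<Longrightarrow> wsrc f = xs \<Longrightarrow> f \<odot> wid M xs = f" "wt f \<Longrightarrow> wtgt f = xs \<Longrightarrow> wid M xs \<odot> f = f"
  by (auto simp: wcomp_def wid_def wtD word_arrow.expand)

lemma word_arrow_eqI:
  "wsrc f = wsrc g \<Longrightarrow> wtgt f = wtgt g \<Longrightarrow> warr f = warr g \<Longrightarrow> f = g"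
  by (simp add: word_arrow.expand)

text \<open>The tensor product of word arrows is characterised by this square, which is handier than its
  definition because it mentions no inverses.\<close>

lemma warr_wtens:
  assumes "wt f" "wt g"
  shows "warr (f \<boxtimes> g) \<cdot> join M (wsrc f) (wsrc g) = join M (wtgt f) (wtgt g) \<cdot> (warr f \<otimes>\<^sub>m warr g)"
  using assms by (simp add: wtens_def wtD)

lemma wtens_interchange:
  assumes "wt f" "wt g" "wt f'" "wt g'" "wtgt f = wsrc g" "wtgt f' = wsrc g'"
  shows "(g \<boxtimes> g') \<odot> (f \<boxtimes> f') = (g \<odot> f) \<boxtimes> (g' \<odot> f')"
  using assms by (simp add: wcomp_def wtens_def wtD interchange_tail)

lemma wtens_wid: "set xs \<subseteq> Obj M \<Longrightarrow> set ys \<subseteq> Obj M \<Longrightarrow> wid M xs \<boxtimes> wid M ys = wid M (xs @ ys)"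
  by (simp add: wid_def wtens_def)

text \<open>Both sides are conjugates of \<open>(f \<otimes> g) \<otimes> h\<close>, resp. \<open>f \<otimes> (g \<otimes> h)\<close>, by the canonical isomorphisms
  that join three words, and by \<open>join_join\<close> these
  isomorphisms differ by the associativity constraint.\<close>

lemma wtens_assoc:
  assumes f: "wt f" and g: "wt g" and h: "wt h"
  shows "(f \<boxtimes> g) \<boxtimes> h = f \<boxtimes> (g \<boxtimes> h)"
proof (rule word_arrow_eqI)
  note [simp] = f g h wtD[OF f] wtD[OF g] wtD[OF h]
  have fg: "wt (f \<boxtimes> g)" and gh: "wt (g \<boxtimes> h)" and fgh: "wt ((f \<boxtimes> g) \<boxtimes> h)" "wt (f \<boxtimes> (g \<boxtimes> h))"
    by simp_all
  note [simp] = wtD[OF fg] wtD[OF gh] wtD[OF fgh(1)] wtD[OF fgh(2)]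
  let ?t = "word_tensor M"
  let ?K = "join M (wsrc f @ wsrc g) (wsrc h) \<cdot> (join M (wsrc f) (wsrc g) \<otimes>\<^sub>m idn (?t (wsrc h)))"
  have "warr ((f \<boxtimes> g) \<boxtimes> h) \<cdot> ?K
      = (warr ((f \<boxtimes> g) \<boxtimes> h) \<cdot> join M (wsrc f @ wsrc g) (wsrc h))
        \<cdot> (join M (wsrc f) (wsrc g) \<otimes>\<^sub>m idn (?t (wsrc h)))"
    by simp
  also have "\<dots> = join M (wtgt f @ wtgt g) (wtgt h)
        \<cdot> ((warr (f \<boxtimes> g) \<cdot> join M (wsrc f) (wsrc g)) \<otimes>\<^sub>m warr h)"
    using warr_wtens[OF fg h] by (simp add: interchange del: comp_assoc_simp) (simp add: interchange)
  also have "\<dots> = join M (wtgt f @ wtgt g) (wtgt h)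
        \<cdot> (join M (wtgt f) (wtgt g) \<otimes>\<^sub>m idn (?t (wtgt h))) \<cdot> ((warr f \<otimes>\<^sub>m warr g) \<otimes>\<^sub>m warr h)"
    by (simp add: warr_wtens interchange)
  also have "\<dots> = (join M (wtgt f @ wtgt g) (wtgt h)
        \<cdot> (join M (wtgt f) (wtgt g) \<otimes>\<^sub>m idn (?t (wtgt h)))) \<cdot> ((warr f \<otimes>\<^sub>m warr g) \<otimes>\<^sub>m warr h)"
    by simp
  also have "\<dots> = join M (wtgt f) (wtgt g @ wtgt h) \<cdot> (idn (?t (wtgt f)) \<otimes>\<^sub>m join M (wtgt g) (wtgt h))
        \<cdot> \<a> (?t (wtgt f)) (?t (wtgt g)) (?t (wtgt h)) \<cdot> ((warr f \<otimes>\<^sub>m warr g) \<otimes>\<^sub>m warr h)"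
    by (subst join_join) simp_all
  also have "\<dots> = join M (wtgt f) (wtgt g @ wtgt h)
        \<cdot> (warr f \<otimes>\<^sub>m (join M (wtgt g) (wtgt h) \<cdot> (warr g \<otimes>\<^sub>m warr h)))
        \<cdot> \<a> (?t (wsrc f)) (?t (wsrc g)) (?t (wsrc h))"
    by (simp add: assoc_nat interchange_tail)
  also have "\<dots> = join M (wtgt f) (wtgt g @ wtgt h)
        \<cdot> (warr f \<otimes>\<^sub>m (warr (g \<boxtimes> h) \<cdot> join M (wsrc g) (wsrc h)))
        \<cdot> \<a> (?t (wsrc f)) (?t (wsrc g)) (?t (wsrc h))"
    by (simp add: warr_wtens)
  also have "\<dots> = (join M (wtgt f) (wtgt g @ wtgt h) \<cdot> (warr f \<otimes>\<^sub>m warr (g \<boxtimes> h)))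
        \<cdot> (idn (?t (wsrc f)) \<otimes>\<^sub>m join M (wsrc g) (wsrc h))
        \<cdot> \<a> (?t (wsrc f)) (?t (wsrc g)) (?t (wsrc h))"
    by (simp add: interchange_tail)
  also have "\<dots> = warr (f \<boxtimes> (g \<boxtimes> h)) \<cdot> (join M (wsrc f) (wsrc g @ wsrc h)
        \<cdot> (idn (?t (wsrc f)) \<otimes>\<^sub>m join M (wsrc g) (wsrc h))
        \<cdot> \<a> (?t (wsrc f)) (?t (wsrc g)) (?t (wsrc h)))"
    using warr_wtens[OF f gh, symmetric] by simp
  also have "\<dots> = warr (f \<boxtimes> (g \<boxtimes> h)) \<cdot> ?K"
    by (subst join_join) simp_all
  finally show "warr ((f \<boxtimes> g) \<boxtimes> h) = warr (f \<boxtimes> (g \<boxtimes> h))"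
    by (rule iso_cancel_right[rotated 5]) simp_all
qed simp_all

lemma wtens_Nil [simp]:
  assumes "wt f" shows "f \<boxtimes> wid M [] = f" "wid M [] \<boxtimes> f = f"
proof -
  note [simp] = assms wtD[OF assms]
  have "(\<r> (word_tensor M (wtgt f)) \<cdot> (warr f \<otimes>\<^sub>m idn \<I>)) \<cdot> inv_arr M (\<r> (word_tensor M (wsrc f))) = warr f"
    unfolding runit_nat[OF wtD(1,3)[OF assms]] by simp
  then show "f \<boxtimes> wid M [] = f"
    by (intro word_arrow_eqI) (simp_all add: wtens_def wid_def join_Nil_right)
  have "(\<l> (word_tensor M (wtgt f)) \<cdot> (idn \<I> \<otimes>\<^sub>m warr f)) \<cdot> inv_arr M (\<l> (word_tensor M (wsrc f))) = warr f"
    unfolding lunit_nat[OF wtD(1,3)[OF assms]] by simp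
  then show "wid M [] \<boxtimes> f = f"
    by (intro word_arrow_eqI) (simp_all add: wtens_def wid_def)
qed

section \<open>Planar isotopy\<close>

lemma whisker_simps [simp]:
  "wsrc (whisker M xs f ys) = xs @ wsrc f @ ys" "wtgt (whisker M xs f ys) = xs @ wtgt f @ ys"
  "wt f \<Longrightarrow> set xs \<subseteq> Obj M \<Longrightarrow> set ys \<subseteq> Obj M \<Longrightarrow> wt (whisker M xs f ys)"
  by (simp_all add: whisker_def)

lemma whisker_wid [simp]:
  "set xs \<subseteq> Obj M \<Longrightarrow> set ys \<subseteq> Obj M \<Longrightarrow> set zs \<subseteq> Obj M
    \<Longrightarrow> whisker M xs (wid M zs) ys = wid M (xs @ zs @ ys)"
  by (simp add: whisker_def wtens_wid)

lemma whisker_Nil: "wt f \<Longrightarrow> whisker M [] f [] = f"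
  by (simp add: whisker_def)

lemma whisker_whisker [simp]:
  "wt f \<Longrightarrow> set xs \<subseteq> Obj M \<Longrightarrow> set ys \<subseteq> Obj M \<Longrightarrow> set xs' \<subseteq> Obj M \<Longrightarrow> set ys' \<subseteq> Obj M
    \<Longrightarrow> whisker M xs (whisker M xs' f ys') ys = whisker M (xs @ xs') f (ys' @ ys)"
  by (simp add: whisker_def wtens_assoc flip: wtens_wid)

lemma whisker_wcomp [simp]:
  "wt f \<Longrightarrow> wt g \<Longrightarrow> set xs \<subseteq> Obj M \<Longrightarrow> set ys \<subseteq> Obj M \<Longrightarrow> wtgt f = wsrc g
    \<Longrightarrow> whisker M xs (g \<odot> f) ys = whisker M xs g ys \<odot> whisker M xs f ys"
  by (simp add: whisker_def wtens_interchange)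

text \<open>Every tensor product is resolved into layers, the right factor acting first. With the rules
  for composites and nested layers this turns any diagram into a composite of layers.\<close>

lemma whisker_wtens [simp]:
  assumes "wt f" "wt g" "set xs \<subseteq> Obj M" "set ys \<subseteq> Obj M"
  shows "whisker M xs (f \<boxtimes> g) ys = whisker M xs f (wtgt g @ ys) \<odot> whisker M (xs @ wsrc f) g ys"
proof -
  have "f \<boxtimes> g = (f \<boxtimes> wid M (wtgt g)) \<odot> (wid M (wsrc f) \<boxtimes> g)"
    using assms by (simp add: wtens_interchange)
  then have "whisker M xs (f \<boxtimes> g) ys
      = whisker M xs (f \<boxtimes> wid M (wtgt g)) ys \<odot> whisker M xs (wid M (wsrc f) \<boxtimes> g) ys"
    using assms by simp
  then show ?thesis using assms by (simp add: whisker_def wtens_assoc flip: wtens_wid)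
qed

lemma wire_wid [simp]: "wire M X = wid M [X]"
  by (simp add: wire_def wid_def)

text \<open>Two generators side by side may act in either order.\<close>

lemma whisker_slide:
  assumes "wt f" "wt g" "set xs \<subseteq> Obj M" "set ys \<subseteq> Obj M" "set zs \<subseteq> Obj M"
  shows "whisker M xs f (zs @ wtgt g @ ys) \<odot> whisker M (xs @ wsrc f @ zs) g ys
    = whisker M (xs @ wtgt f @ zs) g ys \<odot> whisker M xs f (zs @ wsrc g @ ys)"
proof -
  have "whisker M xs f (zs @ wtgt g @ ys) \<odot> whisker M (xs @ wsrc f @ zs) g ys
    = whisker M xs (f \<boxtimes> (wid M zs \<boxtimes> g)) ys"
    using assms by simp
  also have "f \<boxtimes> (wid M zs \<boxtimes> g) = ((wid M (wtgt f @ zs)) \<boxtimes> g) \<odot> (f \<boxtimes> (wid M (zs @ wsrc g)))"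
    using assms by (simp add: wtens_interchange wtens_assoc flip: wtens_wid)
  finally show ?thesis using assms by simp
qed

lemma append_eq_append_split:
  assumes "length xs + length s \<le> length xs'" "xs @ s @ ys = xs' @ t @ ys'"
    and "zs = drop (length xs + length s) xs'"
  shows "xs' = xs @ s @ zs" "ys = zs @ t @ ys'"
proof -
  have "take (length xs + length s) (xs @ s @ ys) = take (length xs + length s) (xs' @ t @ ys')"
    using assms(2) by (rule arg_cong)
  then have "xs @ s = take (length xs + length s) xs'" using assms(1) by simp
  then show xs': "xs' = xs @ s @ zs" unfolding assms(3) by (metis append.assoc append_take_drop_id)
  show "ys = zs @ t @ ys'" using assms(2) unfolding xs' by simp
qed

text \<open>The oriented form of \<open>whisker_slide\<close>: if the later generator \<open>f\<close> lies to the left of the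
  earlier generator \<open>g\<close>, then \<open>f\<close> is moved to act first. The words of idle wires are concrete lists
  in applications, so the wires \<open>zs\<close> between the two generators are computed with \<open>drop\<close>. The last
  hypothesis excludes the case of adjacent generators in which \<open>f\<close> has no outputs and \<open>g\<close> no inputs:
  after the exchange \<open>g\<close>, now the later one, would in turn count as lying to the left of \<open>f\<close>, and
  the rule would apply again.\<close>

lemma whisker_swap:
  assumes "wt f" "wt g" "set xs \<subseteq> Obj M" "set ys \<subseteq> Obj M" "set xs' \<subseteq> Obj M" "set ys' \<subseteq> Obj M"
    and "length xs + length (wsrc f) \<le> length xs'"
    and "xs @ wsrc f @ ys = xs' @ wtgt g @ ys'"
    and zs: "zs = drop (length xs + length (wsrc f)) xs'"
    and ne: "wtgt f \<noteq> [] \<or> wsrc g \<noteq> [] \<or> zs \<noteq> []"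
  shows "whisker M xs f ys \<odot> whisker M xs' g ys' = whisker M (xs @ wtgt f @ zs) g ys' \<odot> whisker M xs f (zs @ wsrc g @ ys')"
proof -
  note eqs = append_eq_append_split[OF assms(7,8) zs]
  have "set zs \<subseteq> Obj M" using assms(5) unfolding eqs(1) by simp
  then show ?thesis unfolding eqs by (intro whisker_slide assms)
qed

lemma whisker_swap_tail:
  assumes "wt f" "wt g" "set xs \<subseteq> Obj M" "set ys \<subseteq> Obj M" "set xs' \<subseteq> Obj M" "set ys' \<subseteq> Obj M"
    and "length xs + length (wsrc f) \<le> length xs'"
    and "xs @ wsrc f @ ys = xs' @ wtgt g @ ys'"
    and zs: "zs = drop (length xs + length (wsrc f)) xs'"
    and "wtgt f \<noteq> [] \<or> wsrc g \<noteq> [] \<or> zs \<noteq> []"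
    and "wt k" "wtgt k = xs' @ wsrc g @ ys'"
  shows "whisker M xs f ys \<odot> whisker M xs' g ys' \<odot> k
    = whisker M (xs @ wtgt f @ zs) g ys' \<odot> whisker M xs f (zs @ wsrc g @ ys') \<odot> k"
proof -
  note eqs = append_eq_append_split[OF assms(7,8) zs]
  have o: "set zs \<subseteq> Obj M" using assms(5) unfolding eqs(1) by simp
  have "(whisker M xs f ys \<odot> whisker M xs' g ys') \<odot> k
    = (whisker M (xs @ wtgt f @ zs) g ys' \<odot> whisker M xs f (zs @ wsrc g @ ys')) \<odot> k"
    by (simp only: whisker_swap[OF assms(1-10)])
  then show ?thesis
    using o assms(1-4,6,11,12) unfolding eqs by simp
qed

text \<open>Wrapping both sides in a layer without idle wires starts the normalisation, since the rewrite
  rules push layers inwards.\<close>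

lemma planarI: "wt f \<Longrightarrow> wt g \<Longrightarrow> whisker M [] f [] = whisker M [] g [] \<Longrightarrow> f = g"
  by (simp add: whisker_Nil)

lemmas planar = whisker_swap[OF _ _ _ _ _ _ _ _ refl] whisker_swap_tail[OF _ _ _ _ _ _ _ _ refl]

end

section \<open>Braids of words\<close>

context braided_monoidal_category begin

lemma wbraid_simps [simp]:
  "wsrc (wbraid M X Y) = [X, Y]" "wtgt (wbraid M X Y) = [Y, X]"
  "X \<in> Obj M \<Longrightarrow> Y \<in> Obj M \<Longrightarrow> wt (wbraid M X Y)"
  by (simp_all add: wbraid_def well_typed_def hom_iff del: wt_objects)

lemma wbraid_natural:
  assumes "wt f" "wt g" "wsrc f = [X]" "wsrc g = [Y]" "wtgt f = [X']" "wtgt g = [Y']"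
  shows "wbraid M X' Y' \<odot> (f \<boxtimes> g) = (g \<boxtimes> f) \<odot> wbraid M X Y"
proof -
  note [simp] = assms wtD[OF assms(1)] wtD[OF assms(2)]
  have [simp]: "X \<in> Obj M" "Y \<in> Obj M" "X' \<in> Obj M" "Y' \<in> Obj M"
    using wt_objects[OF assms(1)] wt_objects[OF assms(2)] by simp_all
  show ?thesis by (simp add: wcomp_def wtens_def wbraid_def braid_nat)
qed

text \<open>A strand that starts at a generator without inputs can be pulled off a crossing: the braiding
  with the unit object is trivial.\<close>

lemma wbraid_unit_left:
  assumes "wt f" "wsrc f = []" "wtgt f = [X]" and [simp]: "Y \<in> Obj M"
  shows "wbraid M X Y \<odot> (f \<boxtimes> wire M Y) = wire M Y \<boxtimes> f"
proof -
  note [simp] = assms(1-3) wtD[OF assms(1)]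
  have [simp]: "X \<in> Obj M" using wt_objects[OF assms(1)] by simp
  have "\<c> X Y \<cdot> (warr f \<otimes>\<^sub>m idn Y) \<cdot> inv_arr M (\<l> Y)
      = (idn Y \<otimes>\<^sub>m warr f) \<cdot> \<c> \<I> Y \<cdot> inv_arr M (\<r> Y \<cdot> \<c> \<I> Y)"
    by (simp add: braid_nat braid_unit_left flip: comp_assoc_simp)
  also have "inv_arr M (\<r> Y \<cdot> \<c> \<I> Y) = inv_arr M (\<c> \<I> Y) \<cdot> inv_arr M (\<r> Y)"
    by (intro inv_arr_eqI inverse_arrows_comp inverse_arrows_inv_arr) simp_all
  finally show ?thesis by (simp add: wcomp_def wtens_def wbraid_def wid_def)
qed

lemma wbraid_unit_right:
  assumes "wt f" "wtgt f = []" "wsrc f = [Y]" and [simp]: "X \<in> Obj M"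
  shows "(f \<boxtimes> wire M X) \<odot> wbraid M X Y = wire M X \<boxtimes> f"
proof -
  note [simp] = assms(1-3) wtD[OF assms(1)]
  have [simp]: "Y \<in> Obj M" using wt_objects[OF assms(1)] by simp
  have "\<l> X \<cdot> (warr f \<otimes>\<^sub>m idn X) \<cdot> \<c> X Y = \<l> X \<cdot> \<c> X \<I> \<cdot> (idn X \<otimes>\<^sub>m warr f)"
    by (simp add: braid_nat)
  also have "\<dots> = \<r> X \<cdot> (idn X \<otimes>\<^sub>m warr f)"
    by (simp add: braid_unit_right flip: comp_assoc_simp)
  finally show ?thesis by (simp add: wcomp_def wtens_def wbraid_def wid_def)
qed

end

section \<open>Bialgebras as string diagrams\<close>

context monoidal_category begin

definition word_hom :: "('o, 'm) word_arrow \<Rightarrow> 'o list \<Rightarrow> 'o list \<Rightarrow> bool"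
  where "word_hom f xs ys \<longleftrightarrow> wt f \<and> wsrc f = xs \<and> wtgt f = ys"

lemma word_homD: "word_hom f xs ys \<Longrightarrow> wt f" "word_hom f xs ys \<Longrightarrow> wsrc f = xs"
  "word_hom f xs ys \<Longrightarrow> wtgt f = ys"
  by (simp_all add: word_hom_def)

end

locale word_bialgebra = braided_monoidal_category +
  fixes X and m u \<Delta> \<epsilon> :: "('a, 'b) word_arrow"
  assumes object [simp]: "X \<in> Obj M"
    and mul_hom: "word_hom m [X, X] [X]" and unit_hom: "word_hom u [] [X]"
    and comul_hom: "word_hom \<Delta> [X] [X, X]" and counit_hom: "word_hom \<epsilon> [X] []"
    and mul_assoc: "m \<odot> (m \<boxtimes> wire M X) = m \<odot> (wire M X \<boxtimes> m)"
    and unit_mul: "m \<odot> (u \<boxtimes> wire M X) = wire M X" and mul_unit: "m \<odot> (wire M X \<boxtimes> u) = wire M X"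
    and comul_coassoc: "(\<Delta> \<boxtimes> wire M X) \<odot> \<Delta> = (wire M X \<boxtimes> \<Delta>) \<odot> \<Delta>"
    and counit_comul: "(\<epsilon> \<boxtimes> wire M X) \<odot> \<Delta> = wire M X"
    and comul_counit: "(wire M X \<boxtimes> \<epsilon>) \<odot> \<Delta> = wire M X"
    and comul_mul: "\<Delta> \<odot> m = (m \<boxtimes> m) \<odot> (wire M X \<boxtimes> wbraid M X X \<boxtimes> wire M X) \<odot> (\<Delta> \<boxtimes> \<Delta>)"
    and counit_mul: "\<epsilon> \<odot> m = \<epsilon> \<boxtimes> \<epsilon>"
    and comul_unit: "\<Delta> \<odot> u = u \<boxtimes> u"
    and counit_unit: "\<epsilon> \<odot> u = wid M []"
begin

lemmas typing [simp] = word_homD[OF mul_hom] word_homD[OF unit_hom] word_homD[OF comul_hom]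
  word_homD[OF counit_hom]

end

context word_bialgebra begin

text \<open>Between two transported structure maps \<open>f g\<close> cancels. In the compatibility of
  multiplication and comultiplication the four inner factors \<open>f g\<close> have to be created first; the
  two in the middle meet the braiding, which is natural.\<close>

lemma transport:
  assumes f: "word_hom f [Y] [X]" and g: "word_hom g [X] [Y]"
    and gf: "g \<odot> f = wire M Y" and fg: "f \<odot> g = wire M X"
  shows "word_bialgebra M Y (g \<odot> m \<odot> (f \<boxtimes> f)) (g \<odot> u) ((g \<boxtimes> g) \<odot> \<Delta> \<odot> f) (\<epsilon> \<odot> f)"
proof -
  note [simp] = word_homD[OF f] word_homD[OF g]
  have [simp]: "Y \<in> Obj M" using wt_objects[OF word_homD(1)[OF f]] by simp
  let ?m = "g \<odot> m \<odot> (f \<boxtimes> f)" and ?\<Delta> = "(g \<boxtimes> g) \<odot> \<Delta> \<odot> f"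
  let ?X = "wire M X" and ?Y = "wire M Y"
  show ?thesis
  proof
    have "?m \<odot> (?m \<boxtimes> ?Y) = g \<odot> m \<odot> (((f \<odot> g) \<odot> m) \<boxtimes> ?X) \<odot> (f \<boxtimes> f \<boxtimes> f)"
      by (rule planarI) (simp_all add: planar)
    also have "\<dots> = g \<odot> (m \<odot> (m \<boxtimes> ?X)) \<odot> (f \<boxtimes> f \<boxtimes> f)"
      unfolding fg by (rule planarI) (simp_all add: planar)
    also have "\<dots> = g \<odot> m \<odot> (?X \<boxtimes> ((f \<odot> g) \<odot> m)) \<odot> (f \<boxtimes> f \<boxtimes> f)"
      unfolding fg mul_assoc by (rule planarI) (simp_all add: planar)
    also have "\<dots> = ?m \<odot> (?Y \<boxtimes> ?m)"
      by (rule planarI) (simp_all add: planar)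
    finally show "?m \<odot> (?m \<boxtimes> ?Y) = ?m \<odot> (?Y \<boxtimes> ?m)" .
    have "?m \<odot> ((g \<odot> u) \<boxtimes> ?Y) = g \<odot> m \<odot> (((f \<odot> g) \<odot> u) \<boxtimes> ?X) \<odot> f"
      by (rule planarI) (simp_all add: planar)
    also have "\<dots> = g \<odot> (m \<odot> (u \<boxtimes> ?X)) \<odot> f"
      unfolding fg by (rule planarI) (simp_all add: planar)
    finally show "?m \<odot> ((g \<odot> u) \<boxtimes> ?Y) = ?Y"
      unfolding unit_mul using gf by simp
    have "?m \<odot> (?Y \<boxtimes> (g \<odot> u)) = g \<odot> m \<odot> (?X \<boxtimes> ((f \<odot> g) \<odot> u)) \<odot> f"
      by (rule planarI) (simp_all add: planar)
    also have "\<dots> = g \<odot> (m \<odot> (?X \<boxtimes> u)) \<odot> f"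
      unfolding fg by (rule planarI) (simp_all add: planar)
    finally show "?m \<odot> (?Y \<boxtimes> (g \<odot> u)) = ?Y"
      unfolding mul_unit using gf by simp
    have "(?\<Delta> \<boxtimes> ?Y) \<odot> ?\<Delta> = (g \<boxtimes> g \<boxtimes> g) \<odot> ((\<Delta> \<odot> (f \<odot> g)) \<boxtimes> ?X) \<odot> \<Delta> \<odot> f"
      by (rule planarI) (simp_all add: planar)
    also have "\<dots> = (g \<boxtimes> g \<boxtimes> g) \<odot> ((\<Delta> \<boxtimes> ?X) \<odot> \<Delta>) \<odot> f"
      unfolding fg by (rule planarI) (simp_all add: planar)
    also have "\<dots> = (g \<boxtimes> g \<boxtimes> g) \<odot> (?X \<boxtimes> (\<Delta> \<odot> (f \<odot> g))) \<odot> \<Delta> \<odot> f"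
      unfolding fg comul_coassoc by (rule planarI) (simp_all add: planar)
    also have "\<dots> = (?Y \<boxtimes> ?\<Delta>) \<odot> ?\<Delta>"
      by (rule planarI) (simp_all add: planar)
    finally show "(?\<Delta> \<boxtimes> ?Y) \<odot> ?\<Delta> = (?Y \<boxtimes> ?\<Delta>) \<odot> ?\<Delta>" .
    have "((\<epsilon> \<odot> f) \<boxtimes> ?Y) \<odot> ?\<Delta> = ((\<epsilon> \<odot> (f \<odot> g)) \<boxtimes> g) \<odot> \<Delta> \<odot> f"
      by (rule planarI) (simp_all add: planar)
    also have "\<dots> = g \<odot> ((\<epsilon> \<boxtimes> ?X) \<odot> \<Delta>) \<odot> f"
      unfolding fg by (rule planarI) (simp_all add: planar)
    finally show "((\<epsilon> \<odot> f) \<boxtimes> ?Y) \<odot> ?\<Delta> = ?Y"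
      unfolding counit_comul using gf by simp
    have "(?Y \<boxtimes> (\<epsilon> \<odot> f)) \<odot> ?\<Delta> = (g \<boxtimes> (\<epsilon> \<odot> (f \<odot> g))) \<odot> \<Delta> \<odot> f"
      by (rule planarI) (simp_all add: planar)
    also have "\<dots> = g \<odot> ((?X \<boxtimes> \<epsilon>) \<odot> \<Delta>) \<odot> f"
      unfolding fg by (rule planarI) (simp_all add: planar)
    finally show "(?Y \<boxtimes> (\<epsilon> \<odot> f)) \<odot> ?\<Delta> = ?Y"
      unfolding comul_counit using gf by simp
    have "?\<Delta> \<odot> ?m = (g \<boxtimes> g) \<odot> \<Delta> \<odot> (f \<odot> g) \<odot> m \<odot> (f \<boxtimes> f)"
      by simp
    also have "\<dots> = (g \<boxtimes> g) \<odot> (\<Delta> \<odot> m) \<odot> (f \<boxtimes> f)"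
      unfolding fg by simp
    \<comment> \<open>The identities on the two middle strands are written as \<open>f g\<close>, to be carried through the braiding.\<close>
    also have "\<dots> = (g \<boxtimes> g) \<odot> (m \<boxtimes> m) \<odot> (?X \<boxtimes> (wbraid M X X \<odot> ((f \<odot> g) \<boxtimes> (f \<odot> g))) \<boxtimes> ?X)
        \<odot> ((\<Delta> \<odot> f) \<boxtimes> (\<Delta> \<odot> f))"
      unfolding comul_mul fg by (rule planarI) (simp_all add: planar)
    also have "\<dots> = ((g \<odot> m) \<boxtimes> (g \<odot> m)) \<odot> (?X \<boxtimes> (wbraid M X X \<odot> (f \<boxtimes> f)) \<boxtimes> ?X)
        \<odot> (?X \<boxtimes> g \<boxtimes> g \<boxtimes> ?X) \<odot> ((\<Delta> \<odot> f) \<boxtimes> (\<Delta> \<odot> f))"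
      by (rule planarI) (simp_all add: planar)
    also have "wbraid M X X \<odot> (f \<boxtimes> f) = (f \<boxtimes> f) \<odot> wbraid M Y Y"
      by (rule wbraid_natural) simp_all
    also have "((g \<odot> m) \<boxtimes> (g \<odot> m)) \<odot> (?X \<boxtimes> ((f \<boxtimes> f) \<odot> wbraid M Y Y) \<boxtimes> ?X)
        \<odot> (?X \<boxtimes> g \<boxtimes> g \<boxtimes> ?X) \<odot> ((\<Delta> \<odot> f) \<boxtimes> (\<Delta> \<odot> f))
      = ((g \<odot> m) \<boxtimes> (g \<odot> m)) \<odot> ((f \<odot> g) \<boxtimes> f \<boxtimes> f \<boxtimes> (f \<odot> g)) \<odot> (?X \<boxtimes> wbraid M Y Y \<boxtimes> ?X)
        \<odot> (?X \<boxtimes> g \<boxtimes> g \<boxtimes> ?X) \<odot> ((\<Delta> \<odot> f) \<boxtimes> (\<Delta> \<odot> f))"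
      unfolding fg by (rule planarI) (simp_all add: planar)
    also have "\<dots> = (?m \<boxtimes> ?m) \<odot> (?Y \<boxtimes> wbraid M Y Y \<boxtimes> ?Y) \<odot> (?\<Delta> \<boxtimes> ?\<Delta>)"
      by (rule planarI) (simp_all add: planar)
    finally show "?\<Delta> \<odot> ?m = (?m \<boxtimes> ?m) \<odot> (?Y \<boxtimes> wbraid M Y Y \<boxtimes> ?Y) \<odot> (?\<Delta> \<boxtimes> ?\<Delta>)" .
    have "(\<epsilon> \<odot> f) \<odot> ?m = \<epsilon> \<odot> (f \<odot> g) \<odot> m \<odot> (f \<boxtimes> f)"
      by simp
    also have "\<dots> = (\<epsilon> \<odot> m) \<odot> (f \<boxtimes> f)"
      unfolding fg by simp
    also have "\<dots> = (\<epsilon> \<odot> f) \<boxtimes> (\<epsilon> \<odot> f)"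
      unfolding counit_mul by (rule planarI) (simp_all add: planar)
    finally show "(\<epsilon> \<odot> f) \<odot> ?m = (\<epsilon> \<odot> f) \<boxtimes> (\<epsilon> \<odot> f)" .
    have "?\<Delta> \<odot> g \<odot> u = (g \<boxtimes> g) \<odot> \<Delta> \<odot> (f \<odot> g) \<odot> u"
      by simp
    also have "\<dots> = (g \<boxtimes> g) \<odot> (\<Delta> \<odot> u)"
      unfolding fg by simp
    also have "\<dots> = (g \<odot> u) \<boxtimes> (g \<odot> u)"
      unfolding comul_unit by (rule planarI) (simp_all add: planar)
    finally show "?\<Delta> \<odot> g \<odot> u = (g \<odot> u) \<boxtimes> (g \<odot> u)" .
    have "(\<epsilon> \<odot> f) \<odot> g \<odot> u = \<epsilon> \<odot> (f \<odot> g) \<odot> u"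
      by simp
    also have "\<dots> = \<epsilon> \<odot> u"
      unfolding fg by simp
    finally show "(\<epsilon> \<odot> f) \<odot> g \<odot> u = wid M []"
      unfolding counit_unit .
  qed (simp_all add: word_hom_def)
qed

end

section \<open>The factorisation of a bialgebra with a right weak projection\<close>

text \<open>The letters \<open>a\<close>, \<open>b\<close>, \<open>r\<close> are the objects of \<open>A\<close>, \<open>B\<close>, \<open>R\<close>. Of the equalizer property, \<open>coinvariant\<close>
  keeps that \<open>i\<close> equalizes; the splitting \<open>p\<close> of \<open>i\<close> takes the place of the universal property.\<close>

locale word_weak_projection = braided_monoidal_category M + A: word_bialgebra M a m u \<Delta> \<epsilon> + B: word_bialgebra M b m\<^sub>B u\<^sub>B \<Delta>\<^sub>B \<epsilon>\<^sub>B
  for M :: "('o, 'm, 'x) braided_monoidal_scheme" (structure)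
    and a m u \<Delta> \<epsilon> b m\<^sub>B u\<^sub>B \<Delta>\<^sub>B \<epsilon>\<^sub>B +
  fixes \<sigma> S \<pi> i p :: "('o, 'm) word_arrow" and r :: 'o
  assumes sub_hom: "word_hom \<sigma> [b] [a]" and antipode_hom: "word_hom S [b] [b]"
    and proj_hom: "word_hom \<pi> [a] [b]" and incl_hom: "word_hom i [r] [a]" and coinv_hom: "word_hom p [a] [r]"
    and r_obj [simp]: "r \<in> Obj M"
    and sub_mul: "\<sigma> \<odot> m\<^sub>B = m \<odot> (\<sigma> \<boxtimes> \<sigma>)" and sub_unit: "\<sigma> \<odot> u\<^sub>B = u"
    and sub_comul: "\<Delta> \<odot> \<sigma> = (\<sigma> \<boxtimes> \<sigma>) \<odot> \<Delta>\<^sub>B" and sub_counit: "\<epsilon> \<odot> \<sigma> = \<epsilon>\<^sub>B"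
    and antipode_left: "m\<^sub>B \<odot> (S \<boxtimes> wire M b) \<odot> \<Delta>\<^sub>B = u\<^sub>B \<odot> \<epsilon>\<^sub>B"
    and antipode_right: "m\<^sub>B \<odot> (wire M b \<boxtimes> S) \<odot> \<Delta>\<^sub>B = u\<^sub>B \<odot> \<epsilon>\<^sub>B"
    and proj_comul: "\<Delta>\<^sub>B \<odot> \<pi> = (\<pi> \<boxtimes> \<pi>) \<odot> \<Delta>" and proj_counit: "\<epsilon>\<^sub>B \<odot> \<pi> = \<epsilon>"
    and proj_linear: "\<pi> \<odot> m \<odot> (wire M a \<boxtimes> \<sigma>) = m\<^sub>B \<odot> (\<pi> \<boxtimes> wire M b)"
    and proj_sub: "\<pi> \<odot> \<sigma> = wire M b"
    and coinvariant: "(wire M a \<boxtimes> \<pi>) \<odot> \<Delta> \<odot> i = i \<boxtimes> u\<^sub>B"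
    and incl_coinv: "i \<odot> p = m \<odot> (wire M a \<boxtimes> (\<sigma> \<odot> S \<odot> \<pi>)) \<odot> \<Delta>"
    and coinv_incl: "p \<odot> i = wire M r"
begin

lemmas typing [simp] = word_homD[OF sub_hom] word_homD[OF antipode_hom] word_homD[OF proj_hom]
  word_homD[OF incl_hom] word_homD[OF coinv_hom]

abbreviation "A \<equiv> wire M a"
abbreviation "B \<equiv> wire M b"
abbreviation "R \<equiv> wire M r"
abbreviation c where "c \<equiv> wbraid M"

text \<open>These are definitions and not abbreviations so that a diagram can be normalised with the
  composites kept as single generators.\<close>

definition \<phi> where "\<phi> = m \<odot> (i \<boxtimes> \<sigma>)"
definition \<psi> where "\<psi> = (p \<boxtimes> \<pi>) \<odot> \<Delta>"
definition m\<^sub>R where "m\<^sub>R = p \<odot> m \<odot> (i \<boxtimes> i)"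
definition u\<^sub>R where "u\<^sub>R = p \<odot> u"
definition \<Delta>\<^sub>R where "\<Delta>\<^sub>R = (p \<boxtimes> p) \<odot> \<Delta> \<odot> i"
definition \<epsilon>\<^sub>R where "\<epsilon>\<^sub>R = \<epsilon> \<odot> i"
definition \<xi> where "\<xi> = \<pi> \<odot> m \<odot> (i \<boxtimes> i)"
definition \<mu>\<^sub>R where "\<mu>\<^sub>R = p \<odot> m \<odot> (\<sigma> \<boxtimes> i)"
definition \<rho>\<^sub>R where "\<rho>\<^sub>R = (\<pi> \<boxtimes> p) \<odot> \<Delta> \<odot> i"
definition \<mu>\<^sub>B where "\<mu>\<^sub>B = \<pi> \<odot> m \<odot> (\<sigma> \<boxtimes> i)"

lemmas cross_defs = \<phi>_def \<psi>_def m\<^sub>R_def u\<^sub>R_def \<Delta>\<^sub>R_def \<epsilon>\<^sub>R_def \<xi>_def \<mu>\<^sub>R_def \<rho>\<^sub>R_def \<mu>\<^sub>B_def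

lemma cross_typing [simp]:
  "wt \<phi>" "wsrc \<phi> = [r, b]" "wtgt \<phi> = [a]" "wt \<psi>" "wsrc \<psi> = [a]" "wtgt \<psi> = [r, b]"
  "wt m\<^sub>R" "wsrc m\<^sub>R = [r, r]" "wtgt m\<^sub>R = [r]" "wt u\<^sub>R" "wsrc u\<^sub>R = []" "wtgt u\<^sub>R = [r]"
  "wt \<Delta>\<^sub>R" "wsrc \<Delta>\<^sub>R = [r]" "wtgt \<Delta>\<^sub>R = [r, r]" "wt \<epsilon>\<^sub>R" "wsrc \<epsilon>\<^sub>R = [r]" "wtgt \<epsilon>\<^sub>R = []"
  "wt \<xi>" "wsrc \<xi> = [r, r]" "wtgt \<xi> = [b]" "wt \<mu>\<^sub>R" "wsrc \<mu>\<^sub>R = [b, r]" "wtgt \<mu>\<^sub>R = [r]"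
  "wt \<rho>\<^sub>R" "wsrc \<rho>\<^sub>R = [r]" "wtgt \<rho>\<^sub>R = [b, r]" "wt \<mu>\<^sub>B" "wsrc \<mu>\<^sub>B = [b, r]" "wtgt \<mu>\<^sub>B = [b]"
  by (simp_all add: cross_defs)

text \<open>The antipode axiom, transferred to \<open>A\<close> along the coalgebra map \<open>\<pi>\<close> and the algebra map \<open>\<sigma>\<close>:
  \<open>\<sigma>S\<pi>(x\<^sub>1) \<sigma>\<pi>(x\<^sub>2) = \<epsilon>(x)\<close>.\<close>

lemma conv_antipode_sub: "m \<odot> (\<sigma> \<boxtimes> \<sigma>) \<odot> (S \<boxtimes> B) \<odot> (\<pi> \<boxtimes> \<pi>) \<odot> \<Delta> = u \<odot> \<epsilon>"
proof -
  have "m \<odot> (\<sigma> \<boxtimes> \<sigma>) \<odot> (S \<boxtimes> B) \<odot> (\<pi> \<boxtimes> \<pi>) \<odot> \<Delta> = (\<sigma> \<odot> m\<^sub>B) \<odot> (S \<boxtimes> B) \<odot> \<Delta>\<^sub>B \<odot> \<pi>"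
    unfolding sub_mul proj_comul by (rule planarI) simp_all
  also have "\<dots> = (\<sigma> \<odot> (m\<^sub>B \<odot> (S \<boxtimes> wire M b) \<odot> \<Delta>\<^sub>B)) \<odot> \<pi>"
    by (rule planarI) simp_all
  also have "\<dots> = (\<sigma> \<odot> u\<^sub>B) \<odot> (\<epsilon>\<^sub>B \<odot> \<pi>)"
    unfolding antipode_left by (rule planarI) simp_all
  finally show ?thesis unfolding sub_unit proj_counit .
qed

text \<open>\<open>\<phi>\<psi>(x) = x\<^sub>1 \<sigma>S\<pi>(x\<^sub>2) \<sigma>\<pi>(x\<^sub>3)\<close>, and the last two factors cancel.\<close>

lemma \<phi>_\<psi>: "\<phi> \<odot> \<psi> = A"
proof -
  have "\<phi> \<odot> \<psi> = m \<odot> ((i \<odot> p) \<boxtimes> (\<sigma> \<odot> \<pi>)) \<odot> \<Delta>"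
    by (rule planarI) (simp_all add: planar cross_defs)
  also have "\<dots> = (m \<odot> (m \<boxtimes> wire M a)) \<odot> (A \<boxtimes> (\<sigma> \<odot> S \<odot> \<pi>) \<boxtimes> (\<sigma> \<odot> \<pi>)) \<odot> ((\<Delta> \<boxtimes> wire M a) \<odot> \<Delta>)"
    unfolding incl_coinv by (rule planarI) (simp_all add: planar cross_defs)
  also have "\<dots> = m \<odot> (A \<boxtimes> (m \<odot> (\<sigma> \<boxtimes> \<sigma>) \<odot> (S \<boxtimes> B) \<odot> (\<pi> \<boxtimes> \<pi>) \<odot> \<Delta>)) \<odot> \<Delta>"
    unfolding A.mul_assoc A.comul_coassoc by (rule planarI) (simp_all add: planar cross_defs)
  also have "\<dots> = (m \<odot> (wire M a \<boxtimes> u)) \<odot> ((wire M a \<boxtimes> \<epsilon>) \<odot> \<Delta>)"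
    unfolding conv_antipode_sub by (rule planarI) (simp_all add: planar cross_defs)
  also have "\<dots> = A"
    unfolding A.mul_unit A.comul_counit by simp
  finally show ?thesis .
qed

text \<open>\<open>S(1) = S(1) 1\<close> is the convolution product of \<open>S\<close> and the identity, evaluated at the unit.\<close>

lemma antipode_unit: "S \<odot> u\<^sub>B = u\<^sub>B"
proof -
  have "S \<odot> u\<^sub>B = (m\<^sub>B \<odot> (B \<boxtimes> u\<^sub>B)) \<odot> S \<odot> u\<^sub>B"
    unfolding B.mul_unit by simp
  also have "\<dots> = m\<^sub>B \<odot> (S \<boxtimes> B) \<odot> (u\<^sub>B \<boxtimes> u\<^sub>B)"
    by (rule planarI) (simp_all add: planar cross_defs)
  also have "\<dots> = (m\<^sub>B \<odot> (S \<boxtimes> B) \<odot> \<Delta>\<^sub>B) \<odot> u\<^sub>B"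
    unfolding B.comul_unit[symmetric] by simp
  also have "\<dots> = u\<^sub>B \<odot> (\<epsilon>\<^sub>B \<odot> u\<^sub>B)"
    unfolding antipode_left by simp
  also have "\<dots> = u\<^sub>B"
    unfolding B.counit_unit by simp
  finally show ?thesis .
qed

text \<open>The map \<open>\<phi>\<close> is right \<open>B\<close>-colinear: \<open>r\<^sub>1 b\<^sub>1 \<otimes> \<pi>(r\<^sub>2 b\<^sub>2) = r\<^sub>1 b\<^sub>1 \<otimes> \<pi>(r\<^sub>2) b\<^sub>2 = r b\<^sub>1 \<otimes> b\<^sub>2\<close>. The strand
  \<open>\<pi>(r\<^sub>2)\<close> has to be pulled back through the crossing with \<open>b\<^sub>1\<close> before it can be recognised as the
  unit.\<close>

lemma coaction_\<phi>: "(A \<boxtimes> \<pi>) \<odot> \<Delta> \<odot> \<phi> = (\<phi> \<boxtimes> B) \<odot> (R \<boxtimes> \<Delta>\<^sub>B)"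
proof -
  have "(A \<boxtimes> \<pi>) \<odot> \<Delta> \<odot> \<phi> = (A \<boxtimes> \<pi>) \<odot> (\<Delta> \<odot> m) \<odot> (i \<boxtimes> \<sigma>)"
    by (simp add: \<phi>_def)
  also have "\<dots> = (m \<boxtimes> (\<pi> \<odot> m)) \<odot> (A \<boxtimes> c a a \<boxtimes> A) \<odot> ((\<Delta> \<odot> i) \<boxtimes> (\<Delta> \<odot> \<sigma>))"
    unfolding A.comul_mul by (rule planarI) (simp_all add: planar cross_defs)
  also have "\<dots> = (m \<boxtimes> (\<pi> \<odot> m \<odot> (A \<boxtimes> \<sigma>))) \<odot> (A \<boxtimes> c a a \<boxtimes> B)
      \<odot> ((\<Delta> \<odot> i) \<boxtimes> ((\<sigma> \<boxtimes> B) \<odot> \<Delta>\<^sub>B))"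
    unfolding sub_comul by (rule planarI) (simp_all add: planar cross_defs)
  also have "\<dots> = (m \<boxtimes> m\<^sub>B) \<odot> (A \<boxtimes> ((A \<boxtimes> \<pi>) \<odot> c a a) \<boxtimes> B)
      \<odot> ((\<Delta> \<odot> i) \<boxtimes> ((\<sigma> \<boxtimes> B) \<odot> \<Delta>\<^sub>B))"
    unfolding proj_linear by (rule planarI) (simp_all add: planar cross_defs)
  also have "(A \<boxtimes> \<pi>) \<odot> c a a = c b a \<odot> (\<pi> \<boxtimes> A)"
    by (rule wbraid_natural[symmetric]) simp_all
  also have "(m \<boxtimes> m\<^sub>B) \<odot> (A \<boxtimes> (c b a \<odot> (\<pi> \<boxtimes> A)) \<boxtimes> B) \<odot> ((\<Delta> \<odot> i) \<boxtimes> ((\<sigma> \<boxtimes> B) \<odot> \<Delta>\<^sub>B))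
    = (m \<boxtimes> m\<^sub>B) \<odot> (A \<boxtimes> c b a \<boxtimes> B) \<odot> (((A \<boxtimes> \<pi>) \<odot> \<Delta> \<odot> i) \<boxtimes> ((\<sigma> \<boxtimes> B) \<odot> \<Delta>\<^sub>B))"
    by (rule planarI) (simp_all add: planar cross_defs)
  also have "\<dots> = (m \<boxtimes> m\<^sub>B) \<odot> (A \<boxtimes> (c b a \<odot> (u\<^sub>B \<boxtimes> A)) \<boxtimes> B) \<odot> (i \<boxtimes> ((\<sigma> \<boxtimes> B) \<odot> \<Delta>\<^sub>B))"
    unfolding coinvariant by (rule planarI) (simp_all add: planar cross_defs)
  also have "c b a \<odot> (u\<^sub>B \<boxtimes> A) = A \<boxtimes> u\<^sub>B"
    by (rule wbraid_unit_left) simp_all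
  also have "(m \<boxtimes> m\<^sub>B) \<odot> (A \<boxtimes> (A \<boxtimes> u\<^sub>B) \<boxtimes> B) \<odot> (i \<boxtimes> ((\<sigma> \<boxtimes> B) \<odot> \<Delta>\<^sub>B))
    = (m \<boxtimes> (m\<^sub>B \<odot> (u\<^sub>B \<boxtimes> B))) \<odot> (i \<boxtimes> ((\<sigma> \<boxtimes> B) \<odot> \<Delta>\<^sub>B))"
    by (rule planarI) (simp_all add: planar cross_defs)
  also have "\<dots> = (\<phi> \<boxtimes> B) \<odot> (R \<boxtimes> \<Delta>\<^sub>B)"
    unfolding B.unit_mul by (rule planarI) (simp_all add: planar cross_defs)
  finally show ?thesis .
qed

text \<open>The other half of the antipode axiom, transferred to \<open>A\<close>: \<open>\<sigma>(b\<^sub>1) \<sigma>S(b\<^sub>2) = \<epsilon>(b)\<close>.\<close>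

lemma conv_sub_antipode: "m \<odot> (\<sigma> \<boxtimes> \<sigma>) \<odot> (B \<boxtimes> S) \<odot> \<Delta>\<^sub>B = u \<odot> \<epsilon>\<^sub>B"
proof -
  have "m \<odot> (\<sigma> \<boxtimes> \<sigma>) \<odot> (B \<boxtimes> S) \<odot> \<Delta>\<^sub>B = (\<sigma> \<odot> m\<^sub>B) \<odot> (B \<boxtimes> S) \<odot> \<Delta>\<^sub>B"
    unfolding sub_mul by (rule planarI) simp_all
  also have "\<dots> = (\<sigma> \<odot> u\<^sub>B) \<odot> \<epsilon>\<^sub>B"
    using antipode_right by simp
  finally show ?thesis unfolding sub_unit .
qed

text \<open>By colinearity, \<open>\<Pi>\<^sub>2\<phi>(r \<otimes> b) = r b\<^sub>1 \<sigma>S(b\<^sub>2) = r \<epsilon>(b)\<close>; then \<open>i\<close> is cancelled with \<open>p\<close>.\<close>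

lemma p_\<phi>: "p \<odot> \<phi> = R \<boxtimes> \<epsilon>\<^sub>B"
proof -
  have "(i \<odot> p) \<odot> \<phi> = m \<odot> (A \<boxtimes> (\<sigma> \<odot> S)) \<odot> ((A \<boxtimes> \<pi>) \<odot> \<Delta> \<odot> \<phi>)"
    unfolding incl_coinv by (rule planarI) (simp_all add: planar cross_defs)
  also have "\<dots> = (m \<odot> (m \<boxtimes> A)) \<odot> (i \<boxtimes> \<sigma> \<boxtimes> (\<sigma> \<odot> S)) \<odot> (R \<boxtimes> \<Delta>\<^sub>B)"
    unfolding coaction_\<phi> by (rule planarI) (simp_all add: planar cross_defs)
  also have "\<dots> = m \<odot> (i \<boxtimes> (m \<odot> (\<sigma> \<boxtimes> \<sigma>) \<odot> (B \<boxtimes> S) \<odot> \<Delta>\<^sub>B))"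
    unfolding A.mul_assoc by (rule planarI) (simp_all add: planar cross_defs)
  also have "\<dots> = (m \<odot> (A \<boxtimes> u)) \<odot> (i \<boxtimes> \<epsilon>\<^sub>B)"
    unfolding conv_sub_antipode by (rule planarI) (simp_all add: planar cross_defs)
  also have "\<dots> = i \<boxtimes> \<epsilon>\<^sub>B"
    unfolding A.mul_unit by simp
  finally have *: "(i \<odot> p) \<odot> \<phi> = i \<boxtimes> \<epsilon>\<^sub>B" .
  have "p \<odot> \<phi> = (p \<odot> i) \<odot> p \<odot> \<phi>"
    unfolding coinv_incl by simp
  also have "\<dots> = p \<odot> ((i \<odot> p) \<odot> \<phi>)"
    by simp
  also have "\<dots> = (p \<odot> i) \<boxtimes> \<epsilon>\<^sub>B"
    unfolding * by (rule planarI) (simp_all add: planar cross_defs)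
  finally show ?thesis unfolding coinv_incl .
qed

lemma \<psi>_\<phi>: "\<psi> \<odot> \<phi> = R \<boxtimes> B"
proof -
  have "\<psi> \<odot> \<phi> = (p \<boxtimes> B) \<odot> ((A \<boxtimes> \<pi>) \<odot> \<Delta> \<odot> \<phi>)"
    by (rule planarI) (simp_all add: planar cross_defs)
  also have "\<dots> = ((p \<odot> \<phi>) \<boxtimes> B) \<odot> (R \<boxtimes> \<Delta>\<^sub>B)"
    unfolding coaction_\<phi> by (rule planarI) (simp_all add: planar cross_defs)
  also have "\<dots> = R \<boxtimes> ((\<epsilon>\<^sub>B \<boxtimes> B) \<odot> \<Delta>\<^sub>B)"
    unfolding p_\<phi> by (rule planarI) (simp_all add: planar cross_defs)
  finally show ?thesis unfolding B.counit_comul .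
qed

lemma p_factorisation: "p = (R \<boxtimes> \<epsilon>\<^sub>B) \<odot> \<psi>"
proof -
  have "p = p \<odot> \<phi> \<odot> \<psi>" unfolding \<phi>_\<psi> by simp
  also have "\<dots> = (p \<odot> \<phi>) \<odot> \<psi>" by simp
  finally show ?thesis unfolding p_\<phi> .
qed

text \<open>Writing \<open>x = \<phi>(r \<otimes> c)\<close>, the product \<open>x \<sigma>(b)\<close> is \<open>\<phi>(r \<otimes> c b)\<close>: under the factorisation, \<open>B\<close>
  multiplies on the right factor alone. Composing with \<open>\<psi>\<close> and with \<open>p\<close> gives the two lemmas
  that follow.\<close>

lemma mul_sub: "m \<odot> (A \<boxtimes> \<sigma>) = \<phi> \<odot> (R \<boxtimes> m\<^sub>B) \<odot> (\<psi> \<boxtimes> B)"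
proof -
  have "m \<odot> (A \<boxtimes> \<sigma>) = m \<odot> ((\<phi> \<odot> \<psi>) \<boxtimes> \<sigma>)"
    unfolding \<phi>_\<psi> ..
  also have "\<dots> = (m \<odot> (m \<boxtimes> A)) \<odot> (i \<boxtimes> \<sigma> \<boxtimes> \<sigma>) \<odot> (\<psi> \<boxtimes> B)"
    by (rule planarI) (simp_all add: planar cross_defs)
  also have "\<dots> = m \<odot> (i \<boxtimes> (m \<odot> (\<sigma> \<boxtimes> \<sigma>))) \<odot> (\<psi> \<boxtimes> B)"
    unfolding A.mul_assoc by (rule planarI) (simp_all add: planar cross_defs)
  also have "\<dots> = \<phi> \<odot> (R \<boxtimes> m\<^sub>B) \<odot> (\<psi> \<boxtimes> B)"
    unfolding sub_mul[symmetric] by (rule planarI) (simp_all add: planar cross_defs)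
  finally show ?thesis .
qed

lemma \<psi>_mul_sub: "\<psi> \<odot> m \<odot> (A \<boxtimes> \<sigma>) = (R \<boxtimes> m\<^sub>B) \<odot> (\<psi> \<boxtimes> B)"
proof -
  have "\<psi> \<odot> m \<odot> (A \<boxtimes> \<sigma>) = (\<psi> \<odot> \<phi>) \<odot> (R \<boxtimes> m\<^sub>B) \<odot> (\<psi> \<boxtimes> B)"
    unfolding mul_sub by simp
  also have "\<dots> = (R \<boxtimes> m\<^sub>B) \<odot> (\<psi> \<boxtimes> B)"
    unfolding \<psi>_\<phi> by (rule planarI) (simp_all add: planar cross_defs)
  finally show ?thesis .
qed

lemma p_mul_sub: "p \<odot> m \<odot> (A \<boxtimes> \<sigma>) = p \<boxtimes> \<epsilon>\<^sub>B"
proof -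
  have "p \<odot> m \<odot> (A \<boxtimes> \<sigma>) = (p \<odot> \<phi>) \<odot> (R \<boxtimes> m\<^sub>B) \<odot> (\<psi> \<boxtimes> B)"
    unfolding mul_sub by simp
  also have "\<dots> = (R \<boxtimes> (\<epsilon>\<^sub>B \<odot> m\<^sub>B)) \<odot> (\<psi> \<boxtimes> B)"
    unfolding p_\<phi> by (rule planarI) (simp_all add: planar cross_defs)
  also have "\<dots> = ((R \<boxtimes> \<epsilon>\<^sub>B) \<odot> \<psi>) \<boxtimes> \<epsilon>\<^sub>B"
    unfolding B.counit_mul by (rule planarI) (simp_all add: planar cross_defs)
  finally show ?thesis unfolding p_factorisation[symmetric] .
qed

section \<open>The coalgebra of coinvariants\<close>

lemma comul_mul_sub: "\<Delta> \<odot> m \<odot> (A \<boxtimes> \<sigma>)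
  = ((m \<odot> (A \<boxtimes> \<sigma>)) \<boxtimes> (m \<odot> (A \<boxtimes> \<sigma>))) \<odot> (A \<boxtimes> c a b \<boxtimes> B) \<odot> (\<Delta> \<boxtimes> \<Delta>\<^sub>B)"
proof -
  have "\<Delta> \<odot> m \<odot> (A \<boxtimes> \<sigma>) = (\<Delta> \<odot> m) \<odot> (A \<boxtimes> \<sigma>)"
    by simp
  also have "\<dots> = (m \<boxtimes> m) \<odot> (A \<boxtimes> c a a \<boxtimes> A) \<odot> (\<Delta> \<boxtimes> (\<Delta> \<odot> \<sigma>))"
    unfolding A.comul_mul by (rule planarI) (simp_all add: planar cross_defs)
  also have "\<dots> = (m \<boxtimes> (m \<odot> (A \<boxtimes> \<sigma>))) \<odot> (A \<boxtimes> (c a a \<odot> (A \<boxtimes> \<sigma>)) \<boxtimes> B) \<odot> (\<Delta> \<boxtimes> \<Delta>\<^sub>B)"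
    unfolding sub_comul by (rule planarI) (simp_all add: planar cross_defs)
  also have "c a a \<odot> (A \<boxtimes> \<sigma>) = (\<sigma> \<boxtimes> A) \<odot> c a b"
    by (rule wbraid_natural) simp_all
  also have "(m \<boxtimes> (m \<odot> (A \<boxtimes> \<sigma>))) \<odot> (A \<boxtimes> ((\<sigma> \<boxtimes> A) \<odot> c a b) \<boxtimes> B) \<odot> (\<Delta> \<boxtimes> \<Delta>\<^sub>B)
    = ((m \<odot> (A \<boxtimes> \<sigma>)) \<boxtimes> (m \<odot> (A \<boxtimes> \<sigma>))) \<odot> (A \<boxtimes> c a b \<boxtimes> B) \<odot> (\<Delta> \<boxtimes> \<Delta>\<^sub>B)"
    by (rule planarI) (simp_all add: planar cross_defs)
  finally show ?thesis .
qed

text \<open>Both legs of \<open>\<Delta>(x \<sigma>(b))\<close> are products with an element of \<open>B\<close>, which \<open>p\<close> turns into counits.\<close>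

lemma pp_comul_mul_sub: "(p \<boxtimes> p) \<odot> \<Delta> \<odot> m \<odot> (A \<boxtimes> \<sigma>) = ((p \<boxtimes> p) \<odot> \<Delta>) \<boxtimes> \<epsilon>\<^sub>B"
proof -
  have "(p \<boxtimes> p) \<odot> \<Delta> \<odot> m \<odot> (A \<boxtimes> \<sigma>)
    = ((p \<odot> m \<odot> (A \<boxtimes> \<sigma>)) \<boxtimes> (p \<odot> m \<odot> (A \<boxtimes> \<sigma>))) \<odot> (A \<boxtimes> c a b \<boxtimes> B) \<odot> (\<Delta> \<boxtimes> \<Delta>\<^sub>B)"
    unfolding comul_mul_sub by (rule planarI) (simp_all add: planar cross_defs)
  also have "\<dots> = (p \<boxtimes> p \<boxtimes> \<epsilon>\<^sub>B) \<odot> (A \<boxtimes> ((\<epsilon>\<^sub>B \<boxtimes> A) \<odot> c a b) \<boxtimes> B) \<odot> (\<Delta> \<boxtimes> \<Delta>\<^sub>B)"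
    unfolding p_mul_sub by (rule planarI) (simp_all add: planar cross_defs)
  also have "(\<epsilon>\<^sub>B \<boxtimes> A) \<odot> c a b = A \<boxtimes> \<epsilon>\<^sub>B"
    by (rule wbraid_unit_right) simp_all
  also have "(p \<boxtimes> p \<boxtimes> \<epsilon>\<^sub>B) \<odot> (A \<boxtimes> (A \<boxtimes> \<epsilon>\<^sub>B) \<boxtimes> B) \<odot> (\<Delta> \<boxtimes> \<Delta>\<^sub>B)
    = ((p \<boxtimes> p) \<odot> \<Delta>) \<boxtimes> (\<epsilon>\<^sub>B \<odot> ((\<epsilon>\<^sub>B \<boxtimes> B) \<odot> \<Delta>\<^sub>B))"
    by (rule planarI) (simp_all add: planar cross_defs)
  also have "\<dots> = ((p \<boxtimes> p) \<odot> \<Delta>) \<boxtimes> \<epsilon>\<^sub>B"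
    unfolding B.counit_comul by simp
  finally show ?thesis .
qed

text \<open>Composed with \<open>\<phi>\<close>, which has the right inverse \<open>\<psi>\<close>, both sides become
  \<open>(p \<otimes> p)\<Delta>i \<otimes> \<epsilon>\<^sub>B\<close>.\<close>

lemma comul_p: "\<Delta>\<^sub>R \<odot> p = (p \<boxtimes> p) \<odot> \<Delta>"
proof -
  have "(p \<boxtimes> p) \<odot> \<Delta> = (p \<boxtimes> p) \<odot> \<Delta> \<odot> (\<phi> \<odot> \<psi>)"
    unfolding \<phi>_\<psi> by simp
  also have "\<dots> = ((p \<boxtimes> p) \<odot> \<Delta> \<odot> m \<odot> (A \<boxtimes> \<sigma>)) \<odot> (i \<boxtimes> B) \<odot> \<psi>"
    by (rule planarI) (simp_all add: planar cross_defs)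
  also have "\<dots> = \<Delta>\<^sub>R \<odot> ((R \<boxtimes> \<epsilon>\<^sub>B) \<odot> \<psi>)"
    unfolding pp_comul_mul_sub by (rule planarI) (simp_all add: planar cross_defs)
  finally show ?thesis unfolding p_factorisation[symmetric] by simp
qed

lemma counit_p: "\<epsilon>\<^sub>R \<odot> p = \<epsilon>"
proof -
  have "\<epsilon> = (\<epsilon> \<odot> m) \<odot> (i \<boxtimes> \<sigma>) \<odot> \<psi>"
    using \<phi>_\<psi> by (simp add: \<phi>_def)
  also have "\<dots> = \<epsilon>\<^sub>R \<odot> (R \<boxtimes> (\<epsilon> \<odot> \<sigma>)) \<odot> \<psi>"
    unfolding A.counit_mul by (rule planarI) (simp_all add: planar cross_defs)
  also have "\<dots> = \<epsilon>\<^sub>R \<odot> ((R \<boxtimes> \<epsilon>\<^sub>B) \<odot> \<psi>)"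
    unfolding sub_counit ..
  finally show ?thesis unfolding p_factorisation[symmetric] by simp
qed

text \<open>Each identity is the image under \<open>p\<close> of the identity in \<open>A\<close>.\<close>

lemma coalgebra_R:
  "(\<Delta>\<^sub>R \<boxtimes> R) \<odot> \<Delta>\<^sub>R = (R \<boxtimes> \<Delta>\<^sub>R) \<odot> \<Delta>\<^sub>R"
  "(\<epsilon>\<^sub>R \<boxtimes> R) \<odot> \<Delta>\<^sub>R = R"
  "(R \<boxtimes> \<epsilon>\<^sub>R) \<odot> \<Delta>\<^sub>R = R"
proof -
  have "(\<Delta>\<^sub>R \<boxtimes> R) \<odot> \<Delta>\<^sub>R = ((\<Delta>\<^sub>R \<odot> p) \<boxtimes> p) \<odot> \<Delta> \<odot> i"
    by (rule planarI) (simp_all add: planar cross_defs)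
  also have "\<dots> = (p \<boxtimes> p \<boxtimes> p) \<odot> ((\<Delta> \<boxtimes> A) \<odot> \<Delta>) \<odot> i"
    unfolding comul_p by (rule planarI) (simp_all add: planar cross_defs)
  also have "\<dots> = (p \<boxtimes> ((p \<boxtimes> p) \<odot> \<Delta>)) \<odot> \<Delta> \<odot> i"
    unfolding A.comul_coassoc by (rule planarI) (simp_all add: planar cross_defs)
  also have "\<dots> = (R \<boxtimes> \<Delta>\<^sub>R) \<odot> \<Delta>\<^sub>R"
    unfolding comul_p[symmetric] by (rule planarI) (simp_all add: planar cross_defs)
  finally show "(\<Delta>\<^sub>R \<boxtimes> R) \<odot> \<Delta>\<^sub>R = (R \<boxtimes> \<Delta>\<^sub>R) \<odot> \<Delta>\<^sub>R" .
  have "(\<epsilon>\<^sub>R \<boxtimes> R) \<odot> \<Delta>\<^sub>R = ((\<epsilon>\<^sub>R \<odot> p) \<boxtimes> p) \<odot> \<Delta> \<odot> i"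
    by (rule planarI) (simp_all add: planar cross_defs)
  also have "\<dots> = p \<odot> ((\<epsilon> \<boxtimes> A) \<odot> \<Delta>) \<odot> i"
    unfolding counit_p by (rule planarI) (simp_all add: planar cross_defs)
  finally show "(\<epsilon>\<^sub>R \<boxtimes> R) \<odot> \<Delta>\<^sub>R = R"
    unfolding A.counit_comul using coinv_incl by simp
  have "(R \<boxtimes> \<epsilon>\<^sub>R) \<odot> \<Delta>\<^sub>R = (p \<boxtimes> (\<epsilon>\<^sub>R \<odot> p)) \<odot> \<Delta> \<odot> i"
    by (rule planarI) (simp_all add: planar cross_defs)
  also have "\<dots> = p \<odot> ((A \<boxtimes> \<epsilon>) \<odot> \<Delta>) \<odot> i"
    unfolding counit_p by (rule planarI) (simp_all add: planar cross_defs)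
  finally show "(R \<boxtimes> \<epsilon>\<^sub>R) \<odot> \<Delta>\<^sub>R = R"
    unfolding A.comul_counit using coinv_incl by simp
qed

section \<open>The cross product structure\<close>

text \<open>\<open>r\<^sub>1 \<otimes> \<Pi>\<^sub>2(r\<^sub>2) = r\<^sub>1 \<otimes> r\<^sub>2 \<sigma>S\<pi>(r\<^sub>3) = r\<^sub>1 \<otimes> r\<^sub>2 \<sigma>S(1) = r\<^sub>1 \<otimes> r\<^sub>2\<close>, by coassociativity: the right leg of
  \<open>\<Delta>i\<close> already lies in \<open>R\<close>.\<close>

lemma comul_incl_coinv: "(A \<boxtimes> (i \<odot> p)) \<odot> \<Delta> \<odot> i = \<Delta> \<odot> i"
proof -
  have "(A \<boxtimes> (i \<odot> p)) \<odot> \<Delta> \<odot> i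
    = (A \<boxtimes> (m \<odot> (A \<boxtimes> (\<sigma> \<odot> S \<odot> \<pi>)))) \<odot> ((A \<boxtimes> \<Delta>) \<odot> \<Delta>) \<odot> i"
    unfolding incl_coinv by (rule planarI) (simp_all add: planar cross_defs)
  also have "\<dots> = (A \<boxtimes> (m \<odot> (A \<boxtimes> (\<sigma> \<odot> S)))) \<odot> (\<Delta> \<boxtimes> B) \<odot> ((A \<boxtimes> \<pi>) \<odot> \<Delta> \<odot> i)"
    unfolding A.comul_coassoc[symmetric] by (rule planarI) (simp_all add: planar cross_defs)
  also have "\<dots> = (A \<boxtimes> (m \<odot> (A \<boxtimes> (\<sigma> \<odot> (S \<odot> u\<^sub>B))))) \<odot> \<Delta> \<odot> i"
    unfolding coinvariant by (rule planarI) (simp_all add: planar cross_defs)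
  also have "\<dots> = \<Delta> \<odot> i"
    unfolding antipode_unit sub_unit A.mul_unit by (rule planarI) (simp_all add: planar cross_defs)
  finally show ?thesis .
qed

text \<open>For \<open>y = s \<sigma>(b)\<close> with \<open>s\<close> in \<open>R\<close>, both sides are \<open>p(x s) \<epsilon>(b)\<close>.\<close>

lemma p_mul_incl_coinv: "p \<odot> m \<odot> (A \<boxtimes> (i \<odot> p)) = p \<odot> m"
proof -
  have "p \<odot> m = p \<odot> m \<odot> (A \<boxtimes> (\<phi> \<odot> \<psi>))"
    unfolding \<phi>_\<psi> by (rule planarI) (simp_all add: planar cross_defs)
  also have "\<dots> = p \<odot> (m \<odot> (A \<boxtimes> m)) \<odot> (A \<boxtimes> ((i \<boxtimes> \<sigma>) \<odot> \<psi>))"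
    by (rule planarI) (simp_all add: planar cross_defs)
  also have "\<dots> = (p \<odot> m \<odot> (A \<boxtimes> \<sigma>)) \<odot> ((m \<odot> (A \<boxtimes> i)) \<boxtimes> B) \<odot> (A \<boxtimes> \<psi>)"
    unfolding A.mul_assoc[symmetric] by (rule planarI) (simp_all add: planar cross_defs)
  also have "\<dots> = p \<odot> m \<odot> (A \<boxtimes> (i \<odot> ((R \<boxtimes> \<epsilon>\<^sub>B) \<odot> \<psi>)))"
    unfolding p_mul_sub by (rule planarI) (simp_all add: planar cross_defs)
  finally show ?thesis unfolding p_factorisation[symmetric] by simp
qed

text \<open>Both sides are \<open>p(r\<^sub>1) \<otimes> \<pi>(r\<^sub>2) \<otimes> p(r\<^sub>3)\<close>.\<close>

lemma \<rho>_comul: "(R \<boxtimes> \<rho>\<^sub>R) \<odot> \<Delta>\<^sub>R = (\<psi> \<boxtimes> p) \<odot> \<Delta> \<odot> i"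
proof -
  have "(R \<boxtimes> \<rho>\<^sub>R) \<odot> \<Delta>\<^sub>R = (p \<boxtimes> \<pi> \<boxtimes> p) \<odot> (A \<boxtimes> \<Delta>) \<odot> ((A \<boxtimes> (i \<odot> p)) \<odot> \<Delta> \<odot> i)"
    by (rule planarI) (simp_all add: planar cross_defs)
  also have "\<dots> = (p \<boxtimes> \<pi> \<boxtimes> p) \<odot> ((A \<boxtimes> \<Delta>) \<odot> \<Delta>) \<odot> i"
    unfolding comul_incl_coinv by (rule planarI) (simp_all add: planar cross_defs)
  also have "\<dots> = (\<psi> \<boxtimes> p) \<odot> \<Delta> \<odot> i"
    unfolding A.comul_coassoc[symmetric] by (rule planarI) (simp_all add: planar cross_defs)
  finally show ?thesis .
qed

text \<open>The right leg of \<open>\<Delta>i\<close> is rewritten as \<open>i p\<close> of itself, so that in the right half of the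
  diagram \<open>\<psi>\<close> meets \<open>\<phi>\<close>; in the left half \<open>\<psi>\<close> is \<open>B\<close>-linear.\<close>

lemma cross_comul:
  "(\<psi> \<boxtimes> \<psi>) \<odot> \<Delta> \<odot> \<phi> = (R \<boxtimes> m\<^sub>B \<boxtimes> R \<boxtimes> B) \<odot> (R \<boxtimes> B \<boxtimes> c r b \<boxtimes> B)
    \<odot> (R \<boxtimes> \<rho>\<^sub>R \<boxtimes> B \<boxtimes> B) \<odot> (\<Delta>\<^sub>R \<boxtimes> \<Delta>\<^sub>B)"
proof -
  have "(\<psi> \<boxtimes> \<psi>) \<odot> \<Delta> \<odot> \<phi> = (\<psi> \<boxtimes> \<psi>) \<odot> (\<Delta> \<odot> m \<odot> (A \<boxtimes> \<sigma>)) \<odot> (i \<boxtimes> B)"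
    by (rule planarI) (simp_all add: planar cross_defs)
  also have "\<dots> = ((\<psi> \<odot> m \<odot> (A \<boxtimes> \<sigma>)) \<boxtimes> (\<psi> \<odot> m \<odot> (A \<boxtimes> \<sigma>)))
      \<odot> (A \<boxtimes> c a b \<boxtimes> B) \<odot> ((\<Delta> \<odot> i) \<boxtimes> \<Delta>\<^sub>B)"
    unfolding comul_mul_sub by (rule planarI) (simp_all add: planar cross_defs)
  also have "\<dots> = ((\<psi> \<odot> m \<odot> (A \<boxtimes> \<sigma>)) \<boxtimes> (\<psi> \<odot> m \<odot> (A \<boxtimes> \<sigma>)))
      \<odot> (A \<boxtimes> c a b \<boxtimes> B) \<odot> (((A \<boxtimes> (i \<odot> p)) \<odot> \<Delta> \<odot> i) \<boxtimes> \<Delta>\<^sub>B)"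
    unfolding comul_incl_coinv ..
  also have "\<dots> = ((\<psi> \<odot> m \<odot> (A \<boxtimes> \<sigma>)) \<boxtimes> (\<psi> \<odot> m \<odot> (A \<boxtimes> \<sigma>)))
      \<odot> (A \<boxtimes> (c a b \<odot> (i \<boxtimes> B)) \<boxtimes> B) \<odot> (((A \<boxtimes> p) \<odot> \<Delta> \<odot> i) \<boxtimes> \<Delta>\<^sub>B)"
    by (rule planarI) (simp_all add: planar cross_defs)
  also have "c a b \<odot> (i \<boxtimes> B) = (B \<boxtimes> i) \<odot> c r b"
    by (rule wbraid_natural) simp_all
  also have "((\<psi> \<odot> m \<odot> (A \<boxtimes> \<sigma>)) \<boxtimes> (\<psi> \<odot> m \<odot> (A \<boxtimes> \<sigma>)))
      \<odot> (A \<boxtimes> ((B \<boxtimes> i) \<odot> c r b) \<boxtimes> B) \<odot> (((A \<boxtimes> p) \<odot> \<Delta> \<odot> i) \<boxtimes> \<Delta>\<^sub>B)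
    = ((\<psi> \<odot> m \<odot> (A \<boxtimes> \<sigma>)) \<boxtimes> (\<psi> \<odot> \<phi>))
      \<odot> (A \<boxtimes> c r b \<boxtimes> B) \<odot> (((A \<boxtimes> p) \<odot> \<Delta> \<odot> i) \<boxtimes> \<Delta>\<^sub>B)"
    by (rule planarI) (simp_all add: planar cross_defs)
  also have "\<dots> = (R \<boxtimes> m\<^sub>B \<boxtimes> R \<boxtimes> B) \<odot> (R \<boxtimes> B \<boxtimes> c r b \<boxtimes> B)
      \<odot> (((\<psi> \<boxtimes> p) \<odot> \<Delta> \<odot> i) \<boxtimes> \<Delta>\<^sub>B)"
    unfolding \<psi>_mul_sub \<psi>_\<phi> by (rule planarI) (simp_all add: planar cross_defs)
  also have "\<dots> = (R \<boxtimes> m\<^sub>B \<boxtimes> R \<boxtimes> B) \<odot> (R \<boxtimes> B \<boxtimes> c r b \<boxtimes> B)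
    \<odot> (R \<boxtimes> \<rho>\<^sub>R \<boxtimes> B \<boxtimes> B) \<odot> (\<Delta>\<^sub>R \<boxtimes> \<Delta>\<^sub>B)"
    unfolding \<rho>_comul[symmetric] by (rule planarI) (simp_all add: planar cross_defs)
  finally show ?thesis .
qed

text \<open>This computes \<open>\<psi>(b s) = p(b\<^sub>1 s\<^sub>1) \<otimes> \<pi>(b\<^sub>2 s\<^sub>2)\<close>. Here \<open>\<Pi>\<^sub>2\<close> can be inserted before \<open>s\<^sub>1\<close>, because of
  \<open>p\<close>, and before \<open>s\<^sub>2\<close>, because \<open>s\<close> lies in \<open>R\<close>.\<close>

lemma cross_mul_left: "(\<mu>\<^sub>R \<boxtimes> \<mu>\<^sub>B) \<odot> (B \<boxtimes> c b r \<boxtimes> R) \<odot> (\<Delta>\<^sub>B \<boxtimes> \<Delta>\<^sub>R) = \<psi> \<odot> m \<odot> (\<sigma> \<boxtimes> i)"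
proof -
  have "\<psi> \<odot> m \<odot> (\<sigma> \<boxtimes> i) = (p \<boxtimes> \<pi>) \<odot> (\<Delta> \<odot> m) \<odot> (\<sigma> \<boxtimes> i)"
    by (simp add: \<psi>_def)
  also have "\<dots> = ((p \<odot> m) \<boxtimes> (\<pi> \<odot> m)) \<odot> (A \<boxtimes> c a a \<boxtimes> A)
      \<odot> ((\<Delta> \<odot> \<sigma>) \<boxtimes> (\<Delta> \<odot> i))"
    unfolding A.comul_mul by (rule planarI) (simp_all add: planar cross_defs)
  also have "\<dots> = ((p \<odot> m) \<boxtimes> (\<pi> \<odot> m)) \<odot> (A \<boxtimes> c a a \<boxtimes> A)
      \<odot> (((\<sigma> \<boxtimes> \<sigma>) \<odot> \<Delta>\<^sub>B) \<boxtimes> ((A \<boxtimes> (i \<odot> p)) \<odot> \<Delta> \<odot> i))"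
    unfolding sub_comul comul_incl_coinv ..
  also have "\<dots> = ((p \<odot> m) \<boxtimes> (\<pi> \<odot> m)) \<odot> (\<sigma> \<boxtimes> (c a a \<odot> (\<sigma> \<boxtimes> A)) \<boxtimes> (i \<odot> p)) \<odot> (\<Delta>\<^sub>B \<boxtimes> (\<Delta> \<odot> i))"
    by (rule planarI) (simp_all add: planar cross_defs)
  also have "c a a \<odot> (\<sigma> \<boxtimes> A) = (A \<boxtimes> \<sigma>) \<odot> c b a"
    by (rule wbraid_natural) simp_all
  also have "((p \<odot> m) \<boxtimes> (\<pi> \<odot> m)) \<odot> (\<sigma> \<boxtimes> ((A \<boxtimes> \<sigma>) \<odot> c b a) \<boxtimes> (i \<odot> p)) \<odot> (\<Delta>\<^sub>B \<boxtimes> (\<Delta> \<odot> i))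
    = ((p \<odot> m) \<boxtimes> (\<pi> \<odot> m)) \<odot> (\<sigma> \<boxtimes> A \<boxtimes> \<sigma> \<boxtimes> (i \<odot> p)) \<odot> (B \<boxtimes> c b a \<boxtimes> A) \<odot> (\<Delta>\<^sub>B \<boxtimes> (\<Delta> \<odot> i))"
    by (rule planarI) (simp_all add: planar cross_defs)
  also have "\<dots> = ((p \<odot> m \<odot> (A \<boxtimes> (i \<odot> p))) \<boxtimes> (\<pi> \<odot> m)) \<odot> (\<sigma> \<boxtimes> A \<boxtimes> \<sigma> \<boxtimes> (i \<odot> p))
      \<odot> (B \<boxtimes> c b a \<boxtimes> A) \<odot> (\<Delta>\<^sub>B \<boxtimes> (\<Delta> \<odot> i))"
    unfolding p_mul_incl_coinv ..
  also have "\<dots> = (\<mu>\<^sub>R \<boxtimes> \<mu>\<^sub>B) \<odot> (B \<boxtimes> ((p \<boxtimes> B) \<odot> c b a) \<boxtimes> R) \<odot> (\<Delta>\<^sub>B \<boxtimes> ((A \<boxtimes> p) \<odot> \<Delta> \<odot> i))"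
    by (rule planarI) (simp_all add: planar cross_defs)
  also have "(p \<boxtimes> B) \<odot> c b a = c b r \<odot> (B \<boxtimes> p)"
    by (rule wbraid_natural[symmetric]) simp_all
  also have "(\<mu>\<^sub>R \<boxtimes> \<mu>\<^sub>B) \<odot> (B \<boxtimes> (c b r \<odot> (B \<boxtimes> p)) \<boxtimes> R) \<odot> (\<Delta>\<^sub>B \<boxtimes> ((A \<boxtimes> p) \<odot> \<Delta> \<odot> i))
    = (\<mu>\<^sub>R \<boxtimes> \<mu>\<^sub>B) \<odot> (B \<boxtimes> c b r \<boxtimes> R) \<odot> (\<Delta>\<^sub>B \<boxtimes> \<Delta>\<^sub>R)"
    by (rule planarI) (simp_all add: planar cross_defs)
  finally show ?thesis ..
qed

text \<open>The inner \<open>i p\<close> is absorbed: \<open>p(r p(b s)) = p((r b) s)\<close>.\<close>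

lemma m\<^sub>R_\<mu>\<^sub>R: "m\<^sub>R \<odot> (R \<boxtimes> \<mu>\<^sub>R) = p \<odot> m \<odot> (\<phi> \<boxtimes> i)"
proof -
  have "m\<^sub>R \<odot> (R \<boxtimes> \<mu>\<^sub>R) = (p \<odot> m \<odot> (A \<boxtimes> (i \<odot> p))) \<odot> (i \<boxtimes> (m \<odot> (\<sigma> \<boxtimes> i)))"
    by (rule planarI) (simp_all add: planar cross_defs)
  also have "\<dots> = p \<odot> (m \<odot> (A \<boxtimes> m)) \<odot> (i \<boxtimes> \<sigma> \<boxtimes> i)"
    unfolding p_mul_incl_coinv by (rule planarI) (simp_all add: planar)
  also have "\<dots> = p \<odot> m \<odot> (\<phi> \<boxtimes> i)"
    unfolding A.mul_assoc[symmetric] by (rule planarI) (simp_all add: planar cross_defs)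
  finally show ?thesis .
qed

text \<open>The left side is \<open>p(r\<^sub>1 t\<^sub>1) \<otimes> \<pi>(r\<^sub>2 t\<^sub>2) = \<psi>(r t)\<close> with \<open>r\<^sub>1\<close> in the form \<open>\<phi>\<psi>(r\<^sub>1)\<close> and with \<open>\<Pi>\<^sub>2\<close> inserted on
  the strands \<open>r\<^sub>2\<close>, \<open>t\<^sub>1\<close> and \<open>t\<^sub>2\<close>. The three insertions are removed one by one; those on \<open>r\<^sub>2\<close> and \<open>t\<^sub>1\<close>
  first have to be carried through the crossing of these two strands.\<close>

lemma cross_mul_right:
  "(m\<^sub>R \<boxtimes> \<xi>) \<odot> (R \<boxtimes> \<mu>\<^sub>R \<boxtimes> R \<boxtimes> R) \<odot> (R \<boxtimes> B \<boxtimes> c r r \<boxtimes> R) \<odot> (R \<boxtimes> \<rho>\<^sub>R \<boxtimes> R \<boxtimes> R)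
    \<odot> (\<Delta>\<^sub>R \<boxtimes> \<Delta>\<^sub>R) = \<psi> \<odot> m \<odot> (i \<boxtimes> i)"
proof -
  have "(m\<^sub>R \<boxtimes> \<xi>) \<odot> (R \<boxtimes> \<mu>\<^sub>R \<boxtimes> R \<boxtimes> R) \<odot> (R \<boxtimes> B \<boxtimes> c r r \<boxtimes> R) \<odot> (R \<boxtimes> \<rho>\<^sub>R \<boxtimes> R \<boxtimes> R) \<odot> (\<Delta>\<^sub>R \<boxtimes> \<Delta>\<^sub>R)
    = ((m\<^sub>R \<odot> (R \<boxtimes> \<mu>\<^sub>R)) \<boxtimes> \<xi>) \<odot> (R \<boxtimes> B \<boxtimes> c r r \<boxtimes> R) \<odot> (((R \<boxtimes> \<rho>\<^sub>R) \<odot> \<Delta>\<^sub>R) \<boxtimes> \<Delta>\<^sub>R)"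
    by (rule planarI) (simp_all add: planar)
  also have "\<dots> = ((p \<odot> m) \<boxtimes> \<xi>) \<odot> (A \<boxtimes> i \<boxtimes> R \<boxtimes> R) \<odot> ((\<phi> \<odot> \<psi>) \<boxtimes> (c r r \<odot> (p \<boxtimes> R)) \<boxtimes> R)
      \<odot> ((\<Delta> \<odot> i) \<boxtimes> \<Delta>\<^sub>R)"
    unfolding m\<^sub>R_\<mu>\<^sub>R \<rho>_comul by (rule planarI) (simp_all add: planar)
  also have "c r r \<odot> (p \<boxtimes> R) = (R \<boxtimes> p) \<odot> c a r"
    by (rule wbraid_natural) simp_all
  also have "((p \<odot> m) \<boxtimes> \<xi>) \<odot> (A \<boxtimes> i \<boxtimes> R \<boxtimes> R) \<odot> ((\<phi> \<odot> \<psi>) \<boxtimes> ((R \<boxtimes> p) \<odot> c a r) \<boxtimes> R) \<odot> ((\<Delta> \<odot> i) \<boxtimes> \<Delta>\<^sub>R)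
    = ((p \<odot> m) \<boxtimes> (\<pi> \<odot> m \<odot> (i \<boxtimes> A))) \<odot> (A \<boxtimes> A \<boxtimes> p \<boxtimes> A) \<odot> (A \<boxtimes> ((i \<boxtimes> A) \<odot> c a r) \<boxtimes> i) \<odot> ((\<Delta> \<odot> i) \<boxtimes> \<Delta>\<^sub>R)"
    unfolding \<phi>_\<psi> \<xi>_def by (rule planarI) (simp_all add: planar)
  also have "(i \<boxtimes> A) \<odot> c a r = c a a \<odot> (A \<boxtimes> i)"
    by (rule wbraid_natural[symmetric]) simp_all
  also have "((p \<odot> m) \<boxtimes> (\<pi> \<odot> m \<odot> (i \<boxtimes> A))) \<odot> (A \<boxtimes> A \<boxtimes> p \<boxtimes> A) \<odot> (A \<boxtimes> (c a a \<odot> (A \<boxtimes> i)) \<boxtimes> i) \<odot> ((\<Delta> \<odot> i) \<boxtimes> \<Delta>\<^sub>R)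
    = ((p \<odot> m) \<boxtimes> (\<pi> \<odot> m)) \<odot> (A \<boxtimes> ((A \<boxtimes> (i \<odot> p)) \<odot> c a a) \<boxtimes> A)
      \<odot> ((\<Delta> \<odot> i) \<boxtimes> (((i \<odot> p) \<boxtimes> A) \<odot> ((A \<boxtimes> (i \<odot> p)) \<odot> \<Delta> \<odot> i)))"
    by (rule planarI) (simp_all add: planar \<Delta>\<^sub>R_def)
  also have "(A \<boxtimes> (i \<odot> p)) \<odot> c a a = c a a \<odot> ((i \<odot> p) \<boxtimes> A)"
    by (rule wbraid_natural[symmetric]) simp_all
  also have "((p \<odot> m) \<boxtimes> (\<pi> \<odot> m)) \<odot> (A \<boxtimes> (c a a \<odot> ((i \<odot> p) \<boxtimes> A)) \<boxtimes> A)
      \<odot> ((\<Delta> \<odot> i) \<boxtimes> (((i \<odot> p) \<boxtimes> A) \<odot> ((A \<boxtimes> (i \<odot> p)) \<odot> \<Delta> \<odot> i)))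
    = ((p \<odot> m) \<boxtimes> (\<pi> \<odot> m)) \<odot> (A \<boxtimes> (c a a \<odot> (A \<boxtimes> (i \<odot> p))) \<boxtimes> A)
      \<odot> (((A \<boxtimes> (i \<odot> p)) \<odot> \<Delta> \<odot> i) \<boxtimes> ((A \<boxtimes> (i \<odot> p)) \<odot> \<Delta> \<odot> i))"
    by (rule planarI) (simp_all add: planar)
  also have "c a a \<odot> (A \<boxtimes> (i \<odot> p)) = ((i \<odot> p) \<boxtimes> A) \<odot> c a a"
    by (rule wbraid_natural) simp_all
  also have "((p \<odot> m) \<boxtimes> (\<pi> \<odot> m)) \<odot> (A \<boxtimes> (((i \<odot> p) \<boxtimes> A) \<odot> c a a) \<boxtimes> A)
      \<odot> (((A \<boxtimes> (i \<odot> p)) \<odot> \<Delta> \<odot> i) \<boxtimes> ((A \<boxtimes> (i \<odot> p)) \<odot> \<Delta> \<odot> i))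
    = ((p \<odot> m \<odot> (A \<boxtimes> (i \<odot> p))) \<boxtimes> (\<pi> \<odot> m)) \<odot> (A \<boxtimes> c a a \<boxtimes> A) \<odot> ((\<Delta> \<odot> i) \<boxtimes> (\<Delta> \<odot> i))"
    unfolding comul_incl_coinv by (rule planarI) (simp_all add: planar)
  also have "\<dots> = (p \<boxtimes> \<pi>) \<odot> ((m \<boxtimes> m) \<odot> (A \<boxtimes> c a a \<boxtimes> A) \<odot> (\<Delta> \<boxtimes> \<Delta>)) \<odot> (i \<boxtimes> i)"
    unfolding p_mul_incl_coinv by (rule planarI) (simp_all add: planar)
  also have "\<dots> = \<psi> \<odot> m \<odot> (i \<boxtimes> i)"
    unfolding A.comul_mul[symmetric] by (simp add: \<psi>_def)
  finally show ?thesis .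
qed

text \<open>\<open>\<psi>((r b)(s c)) = \<psi>(r (b s) c)\<close>: with \<open>\<psi>(b s) = t \<otimes> d\<close> this is \<open>\<psi>(r t d c) = \<psi>(r t) d c\<close>.\<close>

lemma cross_mul:
  "(R \<boxtimes> m\<^sub>B) \<odot> (m\<^sub>R \<boxtimes> \<xi> \<boxtimes> B) \<odot> (R \<boxtimes> \<mu>\<^sub>R \<boxtimes> R \<boxtimes> R \<boxtimes> m\<^sub>B)
    \<odot> (R \<boxtimes> B \<boxtimes> c r r \<boxtimes> R \<boxtimes> B \<boxtimes> B) \<odot> (R \<boxtimes> \<rho>\<^sub>R \<boxtimes> R \<boxtimes> R \<boxtimes> B \<boxtimes> B)
    \<odot> (\<Delta>\<^sub>R \<boxtimes> \<Delta>\<^sub>R \<boxtimes> B \<boxtimes> B) \<odot> (R \<boxtimes> \<mu>\<^sub>R \<boxtimes> \<mu>\<^sub>B \<boxtimes> B)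
    \<odot> (R \<boxtimes> B \<boxtimes> c b r \<boxtimes> R \<boxtimes> B) \<odot> (R \<boxtimes> \<Delta>\<^sub>B \<boxtimes> \<Delta>\<^sub>R \<boxtimes> B)
  = \<psi> \<odot> m \<odot> (\<phi> \<boxtimes> \<phi>)" (is "?L = _")
proof -
  have "?L = (R \<boxtimes> m\<^sub>B)
    \<odot> (((m\<^sub>R \<boxtimes> \<xi>) \<odot> (R \<boxtimes> \<mu>\<^sub>R \<boxtimes> R \<boxtimes> R) \<odot> (R \<boxtimes> B \<boxtimes> c r r \<boxtimes> R) \<odot> (R \<boxtimes> \<rho>\<^sub>R \<boxtimes> R \<boxtimes> R)
    \<odot> (\<Delta>\<^sub>R \<boxtimes> \<Delta>\<^sub>R)) \<boxtimes> m\<^sub>B)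
    \<odot> (R \<boxtimes> ((\<mu>\<^sub>R \<boxtimes> \<mu>\<^sub>B) \<odot> (B \<boxtimes> c b r \<boxtimes> R) \<odot> (\<Delta>\<^sub>B \<boxtimes> \<Delta>\<^sub>R)) \<boxtimes> B)"
    by (rule planarI) (simp_all add: planar)
  \<comment> \<open>The two halves become \<open>\<psi>(r t)\<close> and \<open>t \<otimes> d = \<psi>(b s)\<close>.\<close>
  also have "\<dots> = ((R \<boxtimes> m\<^sub>B) \<odot> (\<psi> \<boxtimes> B)) \<odot> ((m \<odot> (i \<boxtimes> i)) \<boxtimes> m\<^sub>B) \<odot> (R \<boxtimes> (\<psi> \<odot> m \<odot> (\<sigma> \<boxtimes> i)) \<boxtimes> B)"
    unfolding cross_mul_left cross_mul_right by (rule planarI) (simp_all add: planar)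
  also have "\<dots> = \<psi> \<odot> m \<odot> ((m \<odot> (i \<boxtimes> i)) \<boxtimes> (\<sigma> \<odot> m\<^sub>B)) \<odot> (R \<boxtimes> (\<psi> \<odot> m \<odot> (\<sigma> \<boxtimes> i)) \<boxtimes> B)"
    unfolding \<psi>_mul_sub[symmetric] by (rule planarI) (simp_all add: planar)
  also have "\<dots> = \<psi> \<odot> (m \<odot> (m \<boxtimes> A)) \<odot> (i \<boxtimes> i \<boxtimes> (m \<odot> (\<sigma> \<boxtimes> \<sigma>))) \<odot> (R \<boxtimes> (\<psi> \<odot> m \<odot> (\<sigma> \<boxtimes> i)) \<boxtimes> B)"
    unfolding sub_mul by (rule planarI) (simp_all add: planar)
  also have "\<dots> = \<psi> \<odot> m \<odot> (A \<boxtimes> (m \<odot> (A \<boxtimes> m))) \<odot> (i \<boxtimes> i \<boxtimes> \<sigma> \<boxtimes> \<sigma>) \<odot> (R \<boxtimes> (\<psi> \<odot> m \<odot> (\<sigma> \<boxtimes> i)) \<boxtimes> B)"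
    unfolding A.mul_assoc by (rule planarI) (simp_all add: planar)
  \<comment> \<open>Here \<open>t d = \<phi>\<psi>(b s)\<close> appears.\<close>
  also have "\<dots> = \<psi> \<odot> m \<odot> (A \<boxtimes> m) \<odot> (i \<boxtimes> ((\<phi> \<odot> \<psi>) \<odot> m \<odot> (\<sigma> \<boxtimes> i)) \<boxtimes> \<sigma>)"
    unfolding A.mul_assoc[symmetric] by (rule planarI) (simp_all add: planar \<phi>_def)
  also have "\<dots> = \<psi> \<odot> m \<odot> (A \<boxtimes> (m \<odot> (m \<boxtimes> A))) \<odot> (i \<boxtimes> \<sigma> \<boxtimes> i \<boxtimes> \<sigma>)"
    unfolding \<phi>_\<psi> by (rule planarI) (simp_all add: planar)
  also have "\<dots> = \<psi> \<odot> (m \<odot> (A \<boxtimes> m)) \<odot> (i \<boxtimes> \<sigma> \<boxtimes> \<phi>)"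
    unfolding A.mul_assoc by (rule planarI) (simp_all add: planar \<phi>_def)
  also have "\<dots> = \<psi> \<odot> m \<odot> (\<phi> \<boxtimes> \<phi>)"
    unfolding A.mul_assoc[symmetric] by (rule planarI) (simp_all add: planar \<phi>_def)
  finally show ?thesis .
qed

lemma \<psi>_unit: "\<psi> \<odot> u = u\<^sub>R \<boxtimes> u\<^sub>B"
proof -
  have "\<pi> \<odot> u = (\<pi> \<odot> \<sigma>) \<odot> u\<^sub>B"
    by (simp flip: sub_unit)
  also have "\<dots> = u\<^sub>B"
    unfolding proj_sub by simp
  finally have *: "\<pi> \<odot> u = u\<^sub>B" .
  have "\<psi> \<odot> u = (p \<boxtimes> \<pi>) \<odot> (\<Delta> \<odot> u)"
    by (simp add: \<psi>_def)
  also have "\<dots> = u\<^sub>R \<boxtimes> (\<pi> \<odot> u)"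
    unfolding A.comul_unit by (rule planarI) (simp_all add: planar u\<^sub>R_def)
  finally show ?thesis unfolding * .
qed

lemma counit_\<phi>: "\<epsilon> \<odot> \<phi> = \<epsilon>\<^sub>R \<boxtimes> \<epsilon>\<^sub>B"
proof -
  have "\<epsilon> \<odot> \<phi> = (\<epsilon> \<odot> m) \<odot> (i \<boxtimes> \<sigma>)"
    by (simp add: \<phi>_def)
  also have "\<dots> = \<epsilon>\<^sub>R \<boxtimes> (\<epsilon> \<odot> \<sigma>)"
    unfolding A.counit_mul by (rule planarI) (simp_all add: planar \<epsilon>\<^sub>R_def)
  finally show ?thesis unfolding sub_counit .
qed

end

section \<open>From morphisms to string diagrams\<close>

context braided_monoidal_category begin

lemma comp_inv_eq_iff:
  assumes "isomorphism M k" "f \<in> Arr M" "g \<in> Arr M" "Dom M f = Dom M k" "Dom M g = Cod M k"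
  shows "f \<cdot> inv_arr M k = g \<longleftrightarrow> f = g \<cdot> k"
proof
  have [simp]: "k \<in> Arr M" using assms(1) by (rule iso_arr)
  assume "f \<cdot> inv_arr M k = g"
  then have "g \<cdot> k = (f \<cdot> inv_arr M k) \<cdot> k" by simp
  also have "\<dots> = f" using assms by simp
  finally show "f = g \<cdot> k" ..
next
  have [simp]: "k \<in> Arr M" using assms(1) by (rule iso_arr)
  assume "f = g \<cdot> k"
  then have "f \<cdot> inv_arr M k = (g \<cdot> k) \<cdot> inv_arr M k" by simp
  also have "\<dots> = g" using assms by simp
  finally show "f \<cdot> inv_arr M k = g" .
qed

lemma word_hom_Word_arrow [simp]:
  "word_hom (Word_arrow xs f ys) xs' ys' \<longleftrightarrow> xs' = xs \<and> ys' = ys \<and> set xs \<subseteq> Obj M \<and> set ys \<subseteq> Obj M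
    \<and> f \<in> Hom (word_tensor M xs) (word_tensor M ys)"
  by (auto simp: word_hom_def well_typed_def)

text \<open>Between words of length at most three the canonical isomorphisms are identities, unit
  constraints and a single associativity constraint, which the strict form of the axioms absorbs.\<close>

lemma is_algebra_iff:
  "is_algebra M X m u \<longleftrightarrow> X \<in> Obj M \<and> m \<in> Hom (X \<otimes>\<^sub>o X) X \<and> u \<in> Hom \<I> X \<and>
    (let m = Word_arrow [X, X] m [X]; u = Word_arrow [] u [X] in
      m \<odot> (m \<boxtimes> wire M X) = m \<odot> (wire M X \<boxtimes> m) \<and>
      m \<odot> (u \<boxtimes> wire M X) = wire M X \<and> m \<odot> (wire M X \<boxtimes> u) = wire M X)"
  unfolding is_algebra_def Let_def
  by (intro conj_cong refl)
     (simp_all add: wcomp_def wtens_def wid_def hom_iff comp_inv_eq_iff flip: comp_assoc_simp)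

lemma is_coalgebra_iff:
  "is_coalgebra M X \<Delta> \<epsilon> \<longleftrightarrow> X \<in> Obj M \<and> \<Delta> \<in> Hom X (X \<otimes>\<^sub>o X) \<and> \<epsilon> \<in> Hom X \<I> \<and>
    (let \<Delta> = Word_arrow [X] \<Delta> [X, X]; \<epsilon> = Word_arrow [X] \<epsilon> [] in
      (\<Delta> \<boxtimes> wire M X) \<odot> \<Delta> = (wire M X \<boxtimes> \<Delta>) \<odot> \<Delta> \<and>
      (\<epsilon> \<boxtimes> wire M X) \<odot> \<Delta> = wire M X \<and> (wire M X \<boxtimes> \<epsilon>) \<odot> \<Delta> = wire M X)"
  unfolding is_coalgebra_def Let_def
  by (intro conj_cong refl) (simp_all add: wcomp_def wtens_def wid_def hom_iff)

lemma is_bialgebra_iff: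
  "is_bialgebra M H \<longleftrightarrow> word_bialgebra M (bob H) (Word_arrow [bob H, bob H] (bmul H) [bob H])
    (Word_arrow [] (bunit H) [bob H]) (Word_arrow [bob H] (bcomul H) [bob H, bob H])
    (Word_arrow [bob H] (bcounit H) [])" (is "_ \<longleftrightarrow> ?W")
proof -
  let ?X = "bob H" and ?m = "Word_arrow [bob H, bob H] (bmul H) [bob H]" and ?u = "Word_arrow [] (bunit H) [bob H]"
    and ?\<Delta> = "Word_arrow [bob H] (bcomul H) [bob H, bob H]" and ?\<epsilon> = "Word_arrow [bob H] (bcounit H) []"
  have "?W \<longleftrightarrow> is_algebra M ?X (bmul H) (bunit H) \<and> is_coalgebra M ?X (bcomul H) (bcounit H) \<and>
      ?\<Delta> \<odot> ?m = (?m \<boxtimes> ?m) \<odot> (wire M ?X \<boxtimes> wbraid M ?X ?X \<boxtimes> wire M ?X) \<odot> (?\<Delta> \<boxtimes> ?\<Delta>) \<and>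
      ?\<epsilon> \<odot> ?m = ?\<epsilon> \<boxtimes> ?\<epsilon> \<and> ?\<Delta> \<odot> ?u = ?u \<boxtimes> ?u \<and> ?\<epsilon> \<odot> ?u = wid M []"
    unfolding word_bialgebra_def word_bialgebra_axioms_def is_algebra_iff is_coalgebra_iff Let_def
    using braided_monoidal_category_axioms by auto
  also have "\<dots> \<longleftrightarrow> is_bialgebra M H"
    unfolding is_bialgebra_def Let_def
    by (intro conj_cong refl) (simp_all add: is_algebra_def is_coalgebra_def wcomp_def wtens_def wid_def hom_iff m_unit_def \<Delta>_unit_def)
  finally show ?thesis ..
qed

abbreviation word_mul where "word_mul H \<equiv> Word_arrow [bob H, bob H] (bmul H) [bob H]"
abbreviation word_unit where "word_unit H \<equiv> Word_arrow [] (bunit H) [bob H]"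
abbreviation word_comul where "word_comul H \<equiv> Word_arrow [bob H] (bcomul H) [bob H, bob H]"
abbreviation word_counit where "word_counit H \<equiv> Word_arrow [bob H] (bcounit H) []"

lemma is_bialgebra_typing:
  assumes "is_bialgebra M H"
  shows "bob H \<in> Obj M" "bmul H \<in> Hom (bob H \<otimes>\<^sub>o bob H) (bob H)" "bunit H \<in> Hom \<I> (bob H)"
    "bcomul H \<in> Hom (bob H) (bob H \<otimes>\<^sub>o bob H)" "bcounit H \<in> Hom (bob H) \<I>"
  using assms by (simp_all add: is_bialgebra_def is_algebra_def is_coalgebra_def)

text \<open>Only the equalizer identity needs an argument: on words it gives \<open>(A \<otimes> u\<^sub>B) i\<close>, with the source
  word of \<open>i\<close> in place of \<open>r\<^bsub>A\<^esub>\<^sup>-\<^sup>1\<close>, and there \<open>u\<^sub>B\<close> slides past \<open>i\<close>.\<close>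

lemma word_weak_projectionI:
  assumes A: "is_bialgebra M A" and sub: "is_sub_bialgebra M B A \<sigma>" and S: "is_antipode M B S"
    and \<pi>: "is_right_weak_projection M A B \<sigma> \<pi>"
    and eq: "is_equalizer M R i ((idn (bob A) \<otimes>\<^sub>m \<pi>) \<cdot> bcomul A)
           ((idn (bob A) \<otimes>\<^sub>m bunit B) \<cdot> inv_arr M (\<r> (bob A)))"
    and p: "p \<in> Hom (bob A) R"
    and ip: "i \<cdot> p = bmul A \<cdot> (idn (bob A) \<otimes>\<^sub>m (\<sigma> \<cdot> S \<cdot> \<pi>)) \<cdot> bcomul A" and pi: "p \<cdot> i = idn R"
  shows "word_weak_projection M
    (bob A) (word_mul A) (word_unit A) (word_comul A) (word_counit A)
    (bob B) (word_mul B) (word_unit B) (word_comul B) (word_counit B)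
    (Word_arrow [bob B] \<sigma> [bob A]) (Word_arrow [bob B] S [bob B]) (Word_arrow [bob A] \<pi> [bob B])
    (Word_arrow [R] i [bob A]) (Word_arrow [bob A] p [R]) R"
proof -
  have B: "is_bialgebra M B" using sub by (simp add: is_sub_bialgebra_def)
  note [simp] = is_bialgebra_typing[OF A, unfolded hom_iff] is_bialgebra_typing[OF B, unfolded hom_iff]
  have [simp]: "\<sigma> \<in> Arr M" "Dom M \<sigma> = bob B" "Cod M \<sigma> = bob A"
    using sub by (simp_all add: is_sub_bialgebra_def is_algebra_hom_def hom_iff)
  have [simp]: "S \<in> Arr M" "Dom M S = bob B" "Cod M S = bob B"
    using S by (simp_all add: is_antipode_def hom_iff)
  have [simp]: "\<pi> \<in> Arr M" "Dom M \<pi> = bob A" "Cod M \<pi> = bob B"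
    using \<pi> by (simp_all add: is_right_weak_projection_def is_coalgebra_hom_def hom_iff)
  have [simp]: "p \<in> Arr M" "Dom M p = bob A" "Cod M p = R"
    using p by (simp_all add: hom_iff)
  have [simp]: "i \<in> Arr M" "Dom M i = R" "Cod M i = bob A"
    using eq by (simp_all add: is_equalizer_def hom_iff)
  have [simp]: "R \<in> Obj M" using cod_obj[of p] by simp
  have e: "(idn (bob A) \<otimes>\<^sub>m \<pi>) \<cdot> bcomul A \<cdot> i = (idn (bob A) \<otimes>\<^sub>m bunit B) \<cdot> inv_arr M (\<r> (bob A)) \<cdot> i"
    using eq by (simp add: is_equalizer_def)
  let ?A = "wire M (bob A)" and ?i = "Word_arrow [R] i [bob A]"
  have [simp]: "wt ?i" "wt (word_unit B)"
    by (simp_all add: well_typed_def hom_iff)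
  have "(?A \<boxtimes> Word_arrow [bob A] \<pi> [bob B]) \<odot> word_comul A \<odot> ?i = (?A \<boxtimes> word_unit B) \<odot> ?i"
    using e by (simp add: wcomp_def wtens_def wid_def hom_iff)
  also have "\<dots> = ?i \<boxtimes> word_unit B"
    by (rule planarI) (simp_all add: planar)
  finally have coinv: "(?A \<boxtimes> Word_arrow [bob A] \<pi> [bob B]) \<odot> word_comul A \<odot> ?i = ?i \<boxtimes> word_unit B" .
  show ?thesis
    unfolding word_weak_projection_def word_weak_projection_axioms_def
    using sub S \<pi> ip pi A[unfolded is_bialgebra_iff] B[unfolded is_bialgebra_iff] coinv
      braided_monoidal_category_axioms
    by (simp add: is_sub_bialgebra_def is_algebra_hom_def is_coalgebra_hom_def is_antipode_def
      is_right_weak_projection_def wcomp_def wtens_def wid_def hom_iff)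
qed

end

theorem theorem2p12:
  fixes M :: "('o, 'm) braided_monoidal" (structure)
    and A B :: "('o, 'm) bialg"
    and S\<^sub>B \<sigma> \<pi> \<Phi> \<Pi>\<^sub>2 i p m\<^sub>R u\<^sub>R \<Delta>\<^sub>R \<epsilon>\<^sub>R \<xi> \<mu>\<^sub>R \<rho>\<^sub>R \<mu>\<^sub>B :: 'm
    and R :: 'o
  assumes "abelian_coabelian_braided_monoidal_category M"
    and "is_bialgebra M A"
    and "is_sub_bialgebra M B A \<sigma>"
    and "is_antipode M B S\<^sub>B"
    and "is_right_weak_projection M A B \<sigma> \<pi>"
    and "\<Phi> = \<sigma> \<cdot> S\<^sub>B \<cdot> \<pi>"
    and "\<Pi>\<^sub>2 = bmul A \<cdot> (idn (bob A) \<otimes>\<^sub>m \<Phi>) \<cdot> bcomul A"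
    and "is_equalizer M R i
           ((idn (bob A) \<otimes>\<^sub>m \<pi>) \<cdot> bcomul A)
           ((idn (bob A) \<otimes>\<^sub>m bunit B) \<cdot> inv_arr M (\<r> (bob A)))"
    and "p \<in> Hom (bob A) R" and "i \<cdot> p = \<Pi>\<^sub>2" and "p \<cdot> i = idn R"
    and "m\<^sub>R = p \<cdot> bmul A \<cdot> (i \<otimes>\<^sub>m i)"
    and "u\<^sub>R = p \<cdot> bunit A"
    and "\<Delta>\<^sub>R = (p \<otimes>\<^sub>m p) \<cdot> bcomul A \<cdot> i"
    and "\<epsilon>\<^sub>R = bcounit A \<cdot> i"
    and "\<xi> = \<pi> \<cdot> bmul A \<cdot> (i \<otimes>\<^sub>m i)"
    and "\<mu>\<^sub>R = p \<cdot> bmul A \<cdot> (\<sigma> \<otimes>\<^sub>m i)"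
    and "\<rho>\<^sub>R = (\<pi> \<otimes>\<^sub>m p) \<cdot> bcomul A \<cdot> i"
    and "\<mu>\<^sub>B = \<pi> \<cdot> bmul A \<cdot> (\<sigma> \<otimes>\<^sub>m i)"
  shows "(is_coalgebra M R \<Delta>\<^sub>R \<epsilon>\<^sub>R \<and>
          is_coalgebra_hom M (bob A) (bcomul A) (bcounit A) R \<Delta>\<^sub>R \<epsilon>\<^sub>R p) \<and>
         (bmul A \<cdot> (i \<otimes>\<^sub>m \<sigma>) \<in> Hom (R \<otimes>\<^sub>o bob B) (bob A) \<and>
          (p \<otimes>\<^sub>m \<pi>) \<cdot> bcomul A \<in> Hom (bob A) (R \<otimes>\<^sub>o bob B) \<and>
          inverse_arrows M (bmul A \<cdot> (i \<otimes>\<^sub>m \<sigma>)) ((p \<otimes>\<^sub>m \<pi>) \<cdot> bcomul A) \<and>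
          is_bialgebra M (cross_product_bialgebra M B R m\<^sub>R u\<^sub>R \<Delta>\<^sub>R \<epsilon>\<^sub>R \<xi> \<mu>\<^sub>R \<rho>\<^sub>R \<mu>\<^sub>B) \<and>
          transported_bialgebra M A (R \<otimes>\<^sub>o bob B)
              (bmul A \<cdot> (i \<otimes>\<^sub>m \<sigma>)) ((p \<otimes>\<^sub>m \<pi>) \<cdot> bcomul A)
            = cross_product_bialgebra M B R m\<^sub>R u\<^sub>R \<Delta>\<^sub>R \<epsilon>\<^sub>R \<xi> \<mu>\<^sub>R \<rho>\<^sub>R \<mu>\<^sub>B)"
proof -
  interpret braided_monoidal_category M
    using assms(1) by (rule abelian_coabelian_braided_monoidal_category.axioms(2))
  note R_defs = assms(12-19)
  let ?a = "bob A" and ?b = "bob B"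
  let ?\<phi> = "bmul A \<cdot> (i \<otimes>\<^sub>m \<sigma>)" and ?\<psi> = "(p \<otimes>\<^sub>m \<pi>) \<cdot> bcomul A"
  let ?\<sigma> = "Word_arrow [?b] \<sigma> [?a]" and ?S = "Word_arrow [?b] S\<^sub>B [?b]" and ?\<pi> = "Word_arrow [?a] \<pi> [?b]"
    and ?i = "Word_arrow [R] i [?a]" and ?p = "Word_arrow [?a] p [R]"
  interpret W: word_weak_projection M ?a "word_mul A" "word_unit A" "word_comul A" "word_counit A"
    ?b "word_mul B" "word_unit B" "word_comul B" "word_counit B" ?\<sigma> ?S ?\<pi> ?i ?p R
    using assms(2-11) by (intro word_weak_projectionI) simp_all
  have B: "is_bialgebra M B" using assms(3) by (simp add: is_sub_bialgebra_def)
  note [simp] = is_bialgebra_typing[OF assms(2), unfolded hom_iff] is_bialgebra_typing[OF B, unfolded hom_iff]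
  have [simp]: "\<sigma> \<in> Arr M" "Dom M \<sigma> = ?b" "Cod M \<sigma> = ?a" "\<pi> \<in> Arr M" "Dom M \<pi> = ?a" "Cod M \<pi> = ?b"
    "i \<in> Arr M" "Dom M i = R" "Cod M i = ?a" "p \<in> Arr M" "Dom M p = ?a" "Cod M p = R"
    using W.sub_hom W.proj_hom W.incl_hom W.coinv_hom by (simp_all add: hom_iff)
  have words:
    "W.\<phi> = Word_arrow [R, ?b] ?\<phi> [?a]" "W.\<psi> = Word_arrow [?a] ?\<psi> [R, ?b]"
    "W.m\<^sub>R = Word_arrow [R, R] m\<^sub>R [R]" "W.u\<^sub>R = Word_arrow [] u\<^sub>R [R]"
    "W.\<Delta>\<^sub>R = Word_arrow [R] \<Delta>\<^sub>R [R, R]" "W.\<epsilon>\<^sub>R = Word_arrow [R] \<epsilon>\<^sub>R []"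
    "W.\<xi> = Word_arrow [R, R] \<xi> [?b]" "W.\<mu>\<^sub>R = Word_arrow [?b, R] \<mu>\<^sub>R [R]"
    "W.\<rho>\<^sub>R = Word_arrow [R] \<rho>\<^sub>R [?b, R]" "W.\<mu>\<^sub>B = Word_arrow [?b, R] \<mu>\<^sub>B [?b]"
    by (simp_all add: W.cross_defs R_defs wcomp_def wtens_def)
  have [simp]: "\<Delta>\<^sub>R \<in> Arr M" "Dom M \<Delta>\<^sub>R = R" "Cod M \<Delta>\<^sub>R = R \<otimes>\<^sub>o R"
    "\<epsilon>\<^sub>R \<in> Arr M" "Dom M \<epsilon>\<^sub>R = R" "Cod M \<epsilon>\<^sub>R = \<I>"
    "u\<^sub>R \<in> Arr M" "Dom M u\<^sub>R = \<I>" "Cod M u\<^sub>R = R"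
    by (simp_all add: R_defs)
  have coalg: "is_coalgebra M R \<Delta>\<^sub>R \<epsilon>\<^sub>R"
    unfolding is_coalgebra_iff Let_def using W.coalgebra_R unfolding words by (simp add: hom_iff)
  have hom: "is_coalgebra_hom M ?a (bcomul A) (bcounit A) R \<Delta>\<^sub>R \<epsilon>\<^sub>R p"
    using W.comul_p W.counit_p unfolding words
    by (simp add: is_coalgebra_hom_def wcomp_def wtens_def hom_iff)
  have inverse: "?\<psi> \<cdot> ?\<phi> = idn (R \<otimes>\<^sub>o ?b)" "?\<phi> \<cdot> ?\<psi> = idn ?a"
    using W.\<psi>_\<phi> W.\<phi>_\<psi> unfolding words by (simp_all add: wcomp_def wtens_def wid_def del: comp_assoc_simp)
  then have inv: "inverse_arrows M ?\<phi> ?\<psi>"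
    by (simp add: inverse_arrows_def hom_iff del: comp_assoc_simp)
  let ?T = "transported_bialgebra M A (R \<otimes>\<^sub>o ?b) ?\<phi> ?\<psi>"
  \<comment> \<open>Transport is along the single letter \<open>R \<otimes> B\<close>, whereas the formulas above use the word \<open>[R, B]\<close>; the arrows are the same.\<close>
  have "word_bialgebra M (R \<otimes>\<^sub>o ?b) (word_mul ?T) (word_unit ?T) (word_comul ?T) (word_counit ?T)"
    using W.A.transport[of "Word_arrow [R \<otimes>\<^sub>o ?b] ?\<phi> [?a]" "R \<otimes>\<^sub>o ?b" "Word_arrow [?a] ?\<psi> [R \<otimes>\<^sub>o ?b]"] inverse
    by (simp add: transported_bialgebra_def wcomp_def wtens_def wid_def hom_iff)
  then have bialg: "is_bialgebra M ?T"
    by (simp add: is_bialgebra_iff transported_bialgebra_def)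
  have eq: "?T = cross_product_bialgebra M B R m\<^sub>R u\<^sub>R \<Delta>\<^sub>R \<epsilon>\<^sub>R \<xi> \<mu>\<^sub>R \<rho>\<^sub>R \<mu>\<^sub>B"
    unfolding transported_bialgebra_def cross_product_bialgebra_def Let_def
      W.cross_mul[unfolded words] W.cross_comul[unfolded words, symmetric]
    using W.\<psi>_unit W.counit_\<phi> unfolding words
    by (simp add: wcomp_def wtens_def m_unit_def \<Delta>_unit_def)
  show ?thesis
    using coalg hom inv bialg unfolding eq by (simp add: hom_iff)
qed

end
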